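(* Let $m\ge1$ and $N\ge1$ be integers. For every $i\in\{1,\ldots,m\}$, let $v_i$, $w_i$, and $y_i$ be functions in $L^2(\mathbb R^N)$ such that there exists $x_i\in L^2(\mathbb R^N)$ satisfying $\int_{\mathbb R^N}x_i(s)v_i(s)w_i(t-s)\,ds=y_i(t)$ for $\mu$-almost every $t\in\mathbb R^N$. Suppose moreover that there exist measurable sets $(A_i)_{1\le i\le m}$ in $\mathbb R^N$ such that $$(\forall i\in\{1,\ldots,m\})\quad\mu\big((A_i+\operatorname{supp}\widehat{v_i})\cap\operatorname{supp}\widehat{w_i}\big)=0$$ and $$(\forall i\in\{1,\ldots,m-1\})\quad A_i\cup\bigcap_{j=i+1}^mA_j=\mathbb R^N.$$ Then there exists $x\in L^2(\mathbb R^N)$ such that, for every $i\in\{1,\ldots,m\}$, $$\int_{\mathbb R^N}x(s)v_i(s)w_i(t-s)\,ds=y_i(t)\quad\text{for }\mu\text{-almost every }t\in\mathbb R^N.$$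
   Context: $\mu$ is Lebesgue measure on $\mathbb R^N$. $L^2(\mathbb R^N)$ is the space of (real- or complex-valued) square-integrable functions on $\mathbb R^N$; $\widehat{x}$ is the Fourier transform of $x$, and $\operatorname{supp}\widehat{x}$ is its support, i.e. the complement of the largest open set on which $\widehat x$ vanishes almost everywhere. $A+B=\{a+b : a\in A,\ b\in B\}$, and $\mu(E)=0$ means that $E$ is a Lebesgue-null set. *)

theory Defs
  imports "HOL-Analysis.Analysis"
begin

text \<open>
  The scalar field of an \<open>L\<^sup>2\<close> space is a parameter \<open>K\<close>, meant to be \<open>\<real>\<close> or \<open>UNIV\<close> as a set of
  complex numbers, so that real-valued functions have a complex-valued Fourier transform without
  any coercion. Elements are functions, not classes modulo null sets.
\<close>

definition L2_space :: "complex set \<Rightarrow> ('a::euclidean_space \<Rightarrow> complex) set" where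
  "L2_space K = {f. range f \<subseteq> K \<and> f \<in> borel_measurable lebesgue \<and>
                    integrable lebesgue (\<lambda>s. (cmod (f s))\<^sup>2)}"

definition L2_tendsto :: "(nat \<Rightarrow> 'a::euclidean_space \<Rightarrow> complex) \<Rightarrow> ('a \<Rightarrow> complex) \<Rightarrow> bool" where
  "L2_tendsto u f \<longleftrightarrow>
     (\<lambda>n. \<integral>\<^sup>+ s. ennreal ((cmod (u n s - f s))\<^sup>2) \<partial>lebesgue) \<longlonglongrightarrow> 0"

definition fourier_L1 :: "('a::euclidean_space \<Rightarrow> complex) \<Rightarrow> 'a \<Rightarrow> complex" where
  "fourier_L1 f \<xi> = (LINT s|lebesgue. f s * cis (- 2 * pi * (s \<bullet> \<xi>)))"

text \<open>
  Plancherel's extension of the Fourier integral from \<open>L\<^sup>1 \<inter> L\<^sup>2\<close> to \<open>L\<^sup>2\<close> by density. It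
  determines the transform up to a null set, since every \<open>f\<close> in \<open>L\<^sup>2\<close> is the \<open>L\<^sup>2\<close> limit of its
  truncations to balls; \<open>fourier_L2\<close> selects a representative.
\<close>

definition is_fourier_L2 ::
    "('a::euclidean_space \<Rightarrow> complex) \<Rightarrow> ('a \<Rightarrow> complex) \<Rightarrow> bool" where
  "is_fourier_L2 f g \<longleftrightarrow> g \<in> L2_space UNIV \<and>
     (\<forall>u. (\<forall>n. u n \<in> L2_space UNIV \<and> integrable lebesgue (u n)) \<and> L2_tendsto u f
          \<longrightarrow> L2_tendsto (\<lambda>n. fourier_L1 (u n)) g)"

definition fourier_L2 :: "('a::euclidean_space \<Rightarrow> complex) \<Rightarrow> 'a \<Rightarrow> complex" where
  "fourier_L2 f = (SOME g. is_fourier_L2 f g)"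

definition vanishing_set :: "('a::euclidean_space \<Rightarrow> complex) \<Rightarrow> 'a set" where
  "vanishing_set g = \<Union>{U. open U \<and> (AE \<xi> in lebesgue. \<xi> \<in> U \<longrightarrow> g \<xi> = 0)}"

text \<open>The union is itself the largest open set on which \<open>g\<close> vanishes almost everywhere.\<close>

lemma open_vanishing_set: "open (vanishing_set g)"
  unfolding vanishing_set_def by blast

lemma AE_vanishing_set: "AE \<xi> in lebesgue. \<xi> \<in> vanishing_set g \<longrightarrow> g \<xi> = 0"
proof -
  let ?F = "{U. open U \<and> (AE \<xi> in lebesgue. \<xi> \<in> U \<longrightarrow> g \<xi> = 0)}"
  obtain F where F: "F \<subseteq> ?F" "countable F" "\<Union>F = \<Union>?F"
    by (rule Lindelof[of ?F]) auto
  have "AE \<xi> in lebesgue. \<forall>U\<in>F. \<xi> \<in> U \<longrightarrow> g \<xi> = 0"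
    using F by (subst AE_ball_countable) auto
  then show ?thesis
    unfolding vanishing_set_def F(3)[symmetric] by eventually_elim auto
qed

lemma subset_vanishing_set:
  "open U \<Longrightarrow> AE \<xi> in lebesgue. \<xi> \<in> U \<longrightarrow> g \<xi> = 0 \<Longrightarrow> U \<subseteq> vanishing_set g"
  unfolding vanishing_set_def by blast

definition ess_supp :: "('a::euclidean_space \<Rightarrow> complex) \<Rightarrow> 'a set" where
  "ess_supp g = - vanishing_set g"

end

theory Submission
  imports Defs "HOL-Probability.Characteristic_Functions"
begin

text \<open>
  For each \<open>i\<close>, the map taking \<open>x\<close> to the convolution of \<open>x v\<^sub>i\<close> with \<open>w\<^sub>i\<close> does not see the part of
  the transform of \<open>x\<close> that lives on \<open>A\<^sub>i\<close>. Indeed the transform of \<open>x v\<^sub>i\<close> is the convolution of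
  the transforms of \<open>x\<close> and \<open>v\<^sub>i\<close>, so a change of the former on \<open>A\<^sub>i\<close> is felt only on
  \<open>A\<^sub>i + supp\<close> (\<open>supp\<close> being the support of the transform of \<open>v\<^sub>i\<close>), and convolution with \<open>w\<^sub>i\<close> multiplies
  by a transform that vanishes almost everywhere there (\<open>convolve_product_eq\<close>). On the other hand the
  covering hypothesis says exactly that the complements of the sets \<open>A\<^sub>i\<close> are pairwise disjoint. Hence
  one square-integrable function can be prescribed to agree with the transform of the \<open>i\<close>-th given
  solution off \<open>A\<^sub>i\<close>, for all \<open>i\<close> simultaneously (\<open>L2_glue\<close>), and its inverse transform solves all the
  equations. Over the reals, the real part of this solution is taken.

  The argument rests on the \<open>L\<^sup>2\<close> theory of the Fourier transform on a Euclidean space, which is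
  developed from the Gaussian integral. Weighting the energy of a transform with a wide Gaussian
  (\<open>gauss_regularized_energy\<close>) gives first that the transform contracts the \<open>L\<^sup>2\<close> norm, then equality
  for bounded continuous functions, and by density Plancherel's theorem (\<open>Plancherel_L1_L2\<close>). With the
  completeness of \<open>L\<^sup>2\<close> the transform extends to all of \<open>L\<^sup>2\<close>; the multiplication formula identifies its
  adjoint, and an isometry with isometric adjoint is unitary (\<open>inv_fourier_fourier_L2\<close> and
  \<open>fourier_inv_fourier_L2\<close>). Parseval's identity then yields the transform of a product
  (\<open>fourier_L1_product\<close>), and Young's inequality extends the convolution theorem from
  \<open>L\<^sup>1\<close> to \<open>L\<^sup>2\<close> as far as it is needed (\<open>convolve_eq_0\<close>).
\<close>

section \<open>Square-integrable functions\<close>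

abbreviation L2 :: "('a::euclidean_space \<Rightarrow> complex) set" where
  "L2 \<equiv> L2_space UNIV"

definition sq_norm :: "('a::euclidean_space \<Rightarrow> complex) \<Rightarrow> real" where
  "sq_norm f = (LINT s|lebesgue. (cmod (f s))\<^sup>2)"

lemma L2_iff:
  "f \<in> L2 \<longleftrightarrow> f \<in> borel_measurable lebesgue \<and> (\<integral>\<^sup>+ s. ennreal ((cmod (f s))\<^sup>2) \<partial>lebesgue) < \<infinity>"
proof -
  have "f \<in> borel_measurable lebesgue \<Longrightarrow> (\<lambda>s. (cmod (f s))\<^sup>2) \<in> borel_measurable lebesgue"
    by measurable
  then show ?thesis by (auto simp: L2_space_def integrable_iff_bounded)
qed

lemma L2_measurable: "f \<in> L2 \<Longrightarrow> f \<in> borel_measurable lebesgue"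
  by (simp add: L2_space_def)

lemma L2_integrable_sq: "f \<in> L2 \<Longrightarrow> integrable lebesgue (\<lambda>s. (cmod (f s))\<^sup>2)"
  by (simp add: L2_space_def)

lemma L2_space_subset_L2: "f \<in> L2_space K \<Longrightarrow> f \<in> L2"
  by (auto simp: L2_space_def)

lemma nn_integral_sq_norm:
  "f \<in> L2 \<Longrightarrow> (\<integral>\<^sup>+ s. ennreal ((cmod (f s))\<^sup>2) \<partial>lebesgue) = ennreal (sq_norm f)"
  unfolding sq_norm_def by (rule nn_integral_eq_integral[OF L2_integrable_sq]) auto

lemma sq_norm_nonneg: "0 \<le> sq_norm f"
  by (simp add: sq_norm_def)

lemma sq_norm_le_nn:
  assumes "f \<in> L2" "(\<integral>\<^sup>+ s. ennreal ((cmod (f s))\<^sup>2) \<partial>lebesgue) \<le> ennreal c" "0 \<le> c"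
  shows "sq_norm f \<le> c"
  using assms by (simp add: nn_integral_sq_norm)

lemma L2_bound:
  assumes "f \<in> L2" "g \<in> borel_measurable lebesgue" "AE s in lebesgue. cmod (g s) \<le> c * cmod (f s)" "0 \<le> c"
  shows "g \<in> L2" "sq_norm g \<le> c\<^sup>2 * sq_norm f"
proof -
  have m: "(\<lambda>s. (cmod (g s))\<^sup>2) \<in> borel_measurable lebesgue"
    using assms(2) by measurable
  have le: "AE s in lebesgue. (cmod (g s))\<^sup>2 \<le> c\<^sup>2 * (cmod (f s))\<^sup>2"
    using assms(3) by eventually_elim (metis norm_ge_zero power_mono power_mult_distrib)
  have i: "integrable lebesgue (\<lambda>s. c\<^sup>2 * (cmod (f s))\<^sup>2)"
    using L2_integrable_sq[OF assms(1)] by simp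
  have ig: "integrable lebesgue (\<lambda>s. (cmod (g s))\<^sup>2)"
    by (rule Bochner_Integration.integrable_bound[OF i m]) (use le in eventually_elim, auto)
  then show "g \<in> L2" using assms(2) by (simp add: L2_space_def)
  have "sq_norm g \<le> (LINT s|lebesgue. c\<^sup>2 * (cmod (f s))\<^sup>2)"
    unfolding sq_norm_def by (rule integral_mono_AE[OF ig i le])
  then show "sq_norm g \<le> c\<^sup>2 * sq_norm f" by (simp add: sq_norm_def)
qed

lemma cmod_add_sq_le: "(cmod (a + b))\<^sup>2 \<le> 2 * (cmod a)\<^sup>2 + 2 * (cmod b)\<^sup>2"
proof -
  have "(cmod (a + b))\<^sup>2 \<le> (cmod a + cmod b)\<^sup>2"
    by (intro power_mono norm_triangle_ineq) auto
  also have "\<dots> \<le> 2 * (cmod a)\<^sup>2 + 2 * (cmod b)\<^sup>2"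
    using sum_squares_bound[of "cmod a" "cmod b"] by (simp add: power2_sum)
  finally show ?thesis .
qed

lemma L2_add:
  assumes "f \<in> L2" "g \<in> L2"
  shows "(\<lambda>s. f s + g s) \<in> L2" "sq_norm (\<lambda>s. f s + g s) \<le> 2 * sq_norm f + 2 * sq_norm g"
proof -
  note [measurable] = L2_measurable[OF assms(1)] L2_measurable[OF assms(2)]
  have i: "integrable lebesgue (\<lambda>s. 2 * (cmod (f s))\<^sup>2 + 2 * (cmod (g s))\<^sup>2)"
    using L2_integrable_sq[OF assms(1)] L2_integrable_sq[OF assms(2)] by simp
  have ii: "integrable lebesgue (\<lambda>s. (cmod (f s + g s))\<^sup>2)"
    by (rule Bochner_Integration.integrable_bound[OF i]) (auto simp: cmod_add_sq_le intro!: AE_I2)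
  then show "(\<lambda>s. f s + g s) \<in> L2" by (simp add: L2_space_def)
  have "sq_norm (\<lambda>s. f s + g s) \<le> (LINT s|lebesgue. 2 * (cmod (f s))\<^sup>2 + 2 * (cmod (g s))\<^sup>2)"
    unfolding sq_norm_def by (rule integral_mono[OF ii i]) (rule cmod_add_sq_le)
  also have "\<dots> = 2 * sq_norm f + 2 * sq_norm g"
    using L2_integrable_sq[OF assms(1)] L2_integrable_sq[OF assms(2)] by (simp add: sq_norm_def)
  finally show "sq_norm (\<lambda>s. f s + g s) \<le> 2 * sq_norm f + 2 * sq_norm g" .
qed

lemma L2_cmult: "f \<in> L2 \<Longrightarrow> (\<lambda>s. c * f s) \<in> L2"
  by (rule L2_bound(1)[where c="cmod c" and f=f])
     (auto simp: norm_mult intro!: borel_measurable_times dest: L2_measurable)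

lemma L2_cnj: "f \<in> L2 \<Longrightarrow> (\<lambda>s. cnj (f s)) \<in> L2"
  by (rule L2_bound(1)[where c=1 and f=f])
     (auto intro: measurable_compose[OF L2_measurable borel_measurable_continuous_onI[OF continuous_on_cnj[OF continuous_on_id]]])

lemma sq_norm_cnj: "sq_norm (\<lambda>s. cnj (f s)) = sq_norm f"
  by (simp add: sq_norm_def)

lemma sq_norm_minus_commute: "sq_norm (\<lambda>s. f s - g s) = sq_norm (\<lambda>s. g s - f s)"
  by (simp add: sq_norm_def norm_minus_commute)

lemma L2_diff:
  assumes "f \<in> L2" "g \<in> L2"
  shows "(\<lambda>s. f s - g s) \<in> L2"
  using L2_add(1)[OF assms(1) L2_cmult[OF assms(2), of "-1"]] by simp

lemma sq_norm_diff_le: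
  assumes "f \<in> L2" "g \<in> L2" "h \<in> L2"
  shows "sq_norm (\<lambda>s. f s - h s) \<le> 2 * sq_norm (\<lambda>s. f s - g s) + 2 * sq_norm (\<lambda>s. g s - h s)"
  using L2_add(2)[OF L2_diff[OF assms(1,2)] L2_diff[OF assms(2,3)]] by simp

lemma L2_mult_integrable:
  assumes "f \<in> L2" "g \<in> L2"
  shows "integrable lebesgue (\<lambda>s. f s * g s)"
proof -
  note [measurable] = L2_measurable[OF assms(1)] L2_measurable[OF assms(2)]
  have i: "integrable lebesgue (\<lambda>s. (cmod (f s))\<^sup>2 + (cmod (g s))\<^sup>2)"
    using L2_integrable_sq[OF assms(1)] L2_integrable_sq[OF assms(2)] by simp
  have "cmod (f s) * cmod (g s) \<le> (cmod (f s))\<^sup>2 + (cmod (g s))\<^sup>2" for s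
    using sum_squares_bound[of "cmod (f s)" "cmod (g s)"] norm_ge_zero[of "f s"] norm_ge_zero[of "g s"]
      mult_nonneg_nonneg[of "cmod (f s)" "cmod (g s)"] by linarith
  then show ?thesis
    by (intro Bochner_Integration.integrable_bound[OF i]) (auto simp: norm_mult intro!: AE_I2)
qed

lemma Cauchy_Schwarz_L2:
  assumes "f \<in> L2" "g \<in> L2"
  shows "(cmod (LINT s|lebesgue. f s * g s))\<^sup>2 \<le> sq_norm f * sq_norm g"
proof -
  note [measurable] = L2_measurable[OF assms(1)] L2_measurable[OF assms(2)]
  have "ennreal (cmod (LINT s|lebesgue. f s * g s)) \<le> (\<integral>\<^sup>+ s. ennreal (cmod (f s * g s)) \<partial>lebesgue)"
    using integral_norm_bound_ennreal[OF L2_mult_integrable[OF assms]] by simp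
  then have "(ennreal (cmod (LINT s|lebesgue. f s * g s)))\<^sup>2 \<le> (\<integral>\<^sup>+ s. ennreal (cmod (f s)) * ennreal (cmod (g s)) \<partial>lebesgue)\<^sup>2"
    by (intro power_mono) (auto simp: norm_mult ennreal_mult)
  also have "\<dots> \<le> (\<integral>\<^sup>+ s. (ennreal (cmod (f s)))\<^sup>2 \<partial>lebesgue) * (\<integral>\<^sup>+ s. (ennreal (cmod (g s)))\<^sup>2 \<partial>lebesgue)"
    by (rule Cauchy_Schwarz_nn_integral) auto
  also have "\<dots> = ennreal (sq_norm f * sq_norm g)"
    using assms by (simp add: ennreal_power nn_integral_sq_norm ennreal_mult sq_norm_nonneg)
  finally show ?thesis
    by (simp add: ennreal_power sq_norm_nonneg)
qed

lemma L2_tendsto_iff: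
  assumes "\<And>n. u n \<in> L2" "f \<in> L2"
  shows "L2_tendsto u f \<longleftrightarrow> (\<lambda>n. sq_norm (\<lambda>s. u n s - f s)) \<longlonglongrightarrow> 0"
proof -
  have "(\<integral>\<^sup>+ s. ennreal ((cmod (u n s - f s))\<^sup>2) \<partial>lebesgue) = ennreal (sq_norm (\<lambda>s. u n s - f s))" for n
    by (rule nn_integral_sq_norm[OF L2_diff[OF assms(1) assms(2)]])
  then show ?thesis
    unfolding L2_tendsto_def
    using tendsto_ennreal_iff[of "\<lambda>n. sq_norm (\<lambda>s. u n s - f s)" sequentially 0]
    by (simp add: sq_norm_nonneg)
qed

lemma tendsto_0_sq_bound:
  fixes a :: "nat \<Rightarrow> complex"
  assumes "\<And>n. (cmod (a n))\<^sup>2 \<le> b n" "b \<longlonglongrightarrow> 0"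
  shows "a \<longlonglongrightarrow> 0"
proof -
  have "(\<lambda>n. (cmod (a n))\<^sup>2) \<longlonglongrightarrow> 0"
    by (rule tendsto_sandwich[OF _ _ tendsto_const assms(2)]) (auto simp: assms(1))
  then have "(\<lambda>n. sqrt ((cmod (a n))\<^sup>2)) \<longlonglongrightarrow> sqrt 0"
    by (intro tendsto_intros)
  then show ?thesis by (simp add: tendsto_norm_zero_iff)
qed

text \<open>
  Expanding \<open>u v - f g = (u - f) (v - g) + (u - f) g + f (v - g)\<close> reduces joint continuity of the
  pairing to three applications of the Cauchy--Schwarz inequality. Continuity of the norm is the case
  where \<open>v\<close> is the conjugate of \<open>u\<close>.
\<close>

lemma L2_tendsto_integral_mult:
  assumes u: "\<And>n. u n \<in> L2" and f: "f \<in> L2" and uf: "L2_tendsto u f"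
    and v: "\<And>n. v n \<in> L2" and g: "g \<in> L2" and vg: "L2_tendsto v g"
  shows "(\<lambda>n. LINT s|lebesgue. u n s * v n s) \<longlonglongrightarrow> (LINT s|lebesgue. f s * g s)"
proof -
  let ?du = "\<lambda>n s. u n s - f s" and ?dv = "\<lambda>n s. v n s - g s"
  have du: "?du n \<in> L2" and dv: "?dv n \<in> L2" for n
    using u v f g by (auto intro: L2_diff)
  have tu: "(\<lambda>n. sq_norm (?du n)) \<longlonglongrightarrow> 0" using uf L2_tendsto_iff[OF u f] by simp
  have tv: "(\<lambda>n. sq_norm (?dv n)) \<longlonglongrightarrow> 0" using vg L2_tendsto_iff[OF v g] by simp
  have eq: "(LINT s|lebesgue. u n s * v n s) - (LINT s|lebesgue. f s * g s) =
      (LINT s|lebesgue. ?du n s * ?dv n s) + (LINT s|lebesgue. ?du n s * g s) + (LINT s|lebesgue. f s * ?dv n s)" for n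
    using L2_mult_integrable[OF du[of n] dv[of n]] L2_mult_integrable[OF du[of n] g] L2_mult_integrable[OF f dv[of n]]
      L2_mult_integrable[OF u[of n] v[of n]] L2_mult_integrable[OF f g]
    by (subst Bochner_Integration.integral_diff[symmetric], simp, simp,
        subst Bochner_Integration.integral_add[symmetric], simp, simp,
        subst Bochner_Integration.integral_add[symmetric], simp, simp) (simp add: algebra_simps)
  have 1: "(\<lambda>n. LINT s|lebesgue. ?du n s * ?dv n s) \<longlonglongrightarrow> 0"
    by (rule tendsto_0_sq_bound[OF Cauchy_Schwarz_L2[OF du dv]]) (use tendsto_mult[OF tu tv] in simp)
  have 2: "(\<lambda>n. LINT s|lebesgue. ?du n s * g s) \<longlonglongrightarrow> 0"
    by (rule tendsto_0_sq_bound[OF Cauchy_Schwarz_L2[OF du g]]) (use tendsto_mult_right[OF tu] in simp)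
  have 3: "(\<lambda>n. LINT s|lebesgue. f s * ?dv n s) \<longlonglongrightarrow> 0"
    by (rule tendsto_0_sq_bound[OF Cauchy_Schwarz_L2[OF f dv]]) (use tendsto_mult_left[OF tv] in simp)
  have "(\<lambda>n. (LINT s|lebesgue. u n s * v n s) - (LINT s|lebesgue. f s * g s)) \<longlonglongrightarrow> 0"
    unfolding eq using tendsto_add[OF tendsto_add[OF 1 2] 3] by simp
  then show ?thesis by (rule LIM_zero_cancel)
qed

lemma L2_tendsto_cnj: "L2_tendsto u f \<Longrightarrow> L2_tendsto (\<lambda>n s. cnj (u n s)) (\<lambda>s. cnj (f s))"
  by (simp add: L2_tendsto_def flip: complex_cnj_diff)

lemma sq_norm_eq_integral_cnj: "complex_of_real (sq_norm f) = (LINT s|lebesgue. f s * cnj (f s))"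
  unfolding sq_norm_def by (simp add: complex_norm_square flip: integral_complex_of_real of_real_power)

lemma L2_tendsto_sq_norm:
  assumes u: "\<And>n. u n \<in> L2" and f: "f \<in> L2" and uf: "L2_tendsto u f"
  shows "(\<lambda>n. sq_norm (u n)) \<longlonglongrightarrow> sq_norm f"
  using L2_tendsto_integral_mult[OF u f uf L2_cnj[OF u] L2_cnj[OF f] L2_tendsto_cnj[OF uf]]
  by (simp add: tendsto_of_real_iff flip: sq_norm_eq_integral_cnj)

lemma L2_AE_cong:
  assumes "f \<in> L2" "g \<in> borel_measurable lebesgue" "AE s in lebesgue. g s = f s"
  shows "g \<in> L2"
  by (rule L2_bound(1)[OF assms(1,2), where c=1]) (use assms(3) in auto)

lemma sq_norm_AE_cong:
  assumes "f \<in> borel_measurable lebesgue" "g \<in> borel_measurable lebesgue" "AE s in lebesgue. g s = f s"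
  shows "sq_norm g = sq_norm f"
  unfolding sq_norm_def using assms by (intro integral_cong_AE) auto

lemma sq_norm_eq_0_iff: "f \<in> L2 \<Longrightarrow> sq_norm f = 0 \<longleftrightarrow> (AE s in lebesgue. f s = 0)"
  unfolding sq_norm_def by (subst integral_nonneg_eq_0_iff_AE[OF L2_integrable_sq]) auto

lemma L2_tendsto_unique:
  assumes u: "\<And>n. u n \<in> L2" and f: "f \<in> L2" "L2_tendsto u f" and g: "g \<in> L2" "L2_tendsto u g"
  shows "AE s in lebesgue. f s = g s"
proof -
  have "(\<lambda>n. 2 * sq_norm (\<lambda>s. f s - u n s) + 2 * sq_norm (\<lambda>s. u n s - g s)) \<longlonglongrightarrow> 2 * 0 + 2 * 0"
    using f g by (intro tendsto_intros) (simp_all add: L2_tendsto_iff u sq_norm_minus_commute[of f])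
  then have "sq_norm (\<lambda>s. f s - g s) \<le> 2 * 0 + 2 * 0"
    by (rule LIMSEQ_le_const) (auto intro!: sq_norm_diff_le u f g)
  then have "sq_norm (\<lambda>s. f s - g s) = 0" using sq_norm_nonneg[of "\<lambda>s. f s - g s"] by simp
  then show ?thesis using sq_norm_eq_0_iff[OF L2_diff[OF f(1) g(1)]] by simp
qed

text \<open>
  The Riesz--Fischer theorem. A subsequence whose consecutive differences \<open>d k\<close> have squared norm
  below \<open>8\<close> to the power \<open>-k\<close> converges almost everywhere, and Fatou's lemma turns the Cauchy
  estimates into estimates of the distance to the pointwise limit.
\<close>

lemma L2_complete:
  assumes u: "\<And>n. u n \<in> L2"
    and cauchy: "\<And>e. 0 < e \<Longrightarrow> \<exists>N. \<forall>m\<ge>N. \<forall>n\<ge>N. sq_norm (\<lambda>s. u m s - u n s) \<le> e"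
  shows "\<exists>g\<in>L2. L2_tendsto u g"
proof -
  note [measurable] = L2_measurable[OF u]
  have "\<exists>N. \<forall>m\<ge>N. \<forall>n\<ge>N. sq_norm (\<lambda>s. u m s - u n s) \<le> (1/8)^k" for k :: nat
    by (rule cauchy) simp
  then obtain N where N: "\<And>k m n. m \<ge> N k \<Longrightarrow> n \<ge> N k \<Longrightarrow> sq_norm (\<lambda>s. u m s - u n s) \<le> (1/8)^k"
    by metis
  \<comment> \<open>The summand \<open>k\<close> makes the index tend to infinity; the sum keeps it monotone and above \<open>N k\<close>.\<close>
  define r where "r k = k + (\<Sum>j\<le>k. N j)" for k
  have rk: "r k \<ge> k" "r k \<ge> N k" for k
    unfolding r_def by (auto intro: trans_le_add2 member_le_sum)
  have rSuc: "r (Suc k) \<ge> r k" for k by (simp add: r_def)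
  define d where "d k s = u (r (Suc k)) s - u (r k) s" for k s
  have d: "d k \<in> L2" for k unfolding d_def by (intro L2_diff u)
  note [measurable] = L2_measurable[OF d]
  have sd: "sq_norm (d k) \<le> (1/8)^k" for k
    unfolding d_def by (rule N) (use rk(2)[of k] rSuc[of k] in auto)
  \<comment> \<open>The weights \<open>4^k\<close> leave a convergent series of integrals, yet force \<open>d k s\<close> to decay like \<open>2\<close> to the power \<open>-k\<close>.\<close>
  have "(\<integral>\<^sup>+ s. (\<Sum>k. ennreal (4^k * (cmod (d k s))\<^sup>2)) \<partial>lebesgue) =
      (\<Sum>k. \<integral>\<^sup>+ s. ennreal (4^k * (cmod (d k s))\<^sup>2) \<partial>lebesgue)"
    by (rule nn_integral_suminf) auto
  also have "\<dots> = (\<Sum>k. ennreal (4^k * sq_norm (d k)))"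
    by (simp add: ennreal_mult nn_integral_cmult nn_integral_sq_norm[OF d] sq_norm_nonneg)
  also have "\<dots> \<le> (\<Sum>k. ennreal ((1/2)^k))"
  proof (intro suminf_le ennreal_leI summableI)
    fix k
    have "4^k * sq_norm (d k) \<le> 4^k * (1/8)^k" by (intro mult_left_mono sd) auto
    also have "\<dots> = (1/2)^k" by (simp flip: power_mult_distrib)
    finally show "4^k * sq_norm (d k) \<le> (1/2)^k" .
  qed
  also have "\<dots> = ennreal (\<Sum>k. (1/2)^k)"
    by (intro suminf_ennreal2) (auto intro: summable_geometric)
  finally have "(\<integral>\<^sup>+ s. (\<Sum>k. ennreal (4^k * (cmod (d k s))\<^sup>2)) \<partial>lebesgue) \<noteq> \<infinity>"
    by (auto simp: top_unique)
  moreover have "(\<lambda>s. \<Sum>k. ennreal (4^k * (cmod (d k s))\<^sup>2)) \<in> borel_measurable lebesgue"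
    by (rule borel_measurable_suminf_order) measurable
  ultimately have "AE s in lebesgue. (\<Sum>k. ennreal (4^k * (cmod (d k s))\<^sup>2)) \<noteq> \<infinity>"
    by (intro nn_integral_PInf_AE)
  then have conv: "AE s in lebesgue. convergent (\<lambda>k. u (r k) s)"
  proof (rule AE_mp, intro AE_I2 impI)
    fix s assume elim: "(\<Sum>k. ennreal (4^k * (cmod (d k s))\<^sup>2)) \<noteq> \<infinity>"
    define F where "F k = ennreal (4^k * (cmod (d k s))\<^sup>2)" for k
    have "suminf F \<noteq> \<infinity>" using elim unfolding F_def .
    then obtain C where C: "0 \<le> C" "suminf F = ennreal C"
      by (cases "suminf F") auto
    have "cmod (d k s) \<le> sqrt C * (1/2)^k" for k
    proof -
      have "F k \<le> ennreal C"
        unfolding C(2)[symmetric] using sum_le_suminf[of F "{k}"] by (simp add: summableI)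
      then have "ennreal (4^k * (cmod (d k s))\<^sup>2) \<le> ennreal C" unfolding F_def .
      then have "4^k * (cmod (d k s))\<^sup>2 \<le> C" using C(1) by simp
      then have "(2^k * cmod (d k s))\<^sup>2 \<le> C"
        by (simp add: power_mult_distrib power2_eq_square[of "2^k"] flip: power_mult_distrib[of 2 2 k])
      then have "2^k * cmod (d k s) \<le> sqrt C" by (simp add: real_le_rsqrt)
      then show ?thesis by (simp add: field_simps power_one_over)
    qed
    moreover have "summable (\<lambda>k. sqrt C * (1/2)^k)"
      by (rule summable_mult, rule summable_geometric) simp
    ultimately have "summable (\<lambda>k. d k s)"
      by (rule summable_comparison_test'[where N=0, rotated])
    then have "convergent (\<lambda>n. u (r 0) s + (\<Sum>k<n. d k s))"
      by (intro convergent_add convergent_const) (simp add: summable_iff_convergent)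
    moreover have "u (r 0) s + (\<Sum>k<n. d k s) = u (r n) s" for n
      unfolding d_def by (simp add: sum_lessThan_telescope[where f="\<lambda>k. u (r k) s"])
    ultimately show "convergent (\<lambda>k. u (r k) s)" by simp
  qed
  define g where "g s = lim (\<lambda>k. u (r k) s)" for s
  have [measurable]: "g \<in> borel_measurable lebesgue"
    unfolding g_def by (rule borel_measurable_lim_metric) measurable
  have lim: "AE s in lebesgue. (\<lambda>k. u (r k) s) \<longlonglongrightarrow> g s"
    using conv unfolding g_def by eventually_elim (simp add: convergent_LIMSEQ_iff)
  have est: "\<exists>N. \<forall>n\<ge>N. (\<integral>\<^sup>+ s. ennreal ((cmod (u n s - g s))\<^sup>2) \<partial>lebesgue) \<le> ennreal e" if e: "0 < e" for e
  proof -
    obtain M where M: "\<And>m n. m \<ge> M \<Longrightarrow> n \<ge> M \<Longrightarrow> sq_norm (\<lambda>s. u m s - u n s) \<le> e"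
      using cauchy[OF e] by blast
    have "(\<integral>\<^sup>+ s. ennreal ((cmod (u n s - g s))\<^sup>2) \<partial>lebesgue) \<le> ennreal e" if n: "n \<ge> M" for n
    proof -
      have "(\<integral>\<^sup>+ s. ennreal ((cmod (u n s - g s))\<^sup>2) \<partial>lebesgue) =
          (\<integral>\<^sup>+ s. liminf (\<lambda>k. ennreal ((cmod (u n s - u (r k) s))\<^sup>2)) \<partial>lebesgue)"
      proof (rule nn_integral_cong_AE, use lim in eventually_elim)
        case (elim s)
        have "(\<lambda>k. ennreal ((cmod (u n s - u (r k) s))\<^sup>2)) \<longlonglongrightarrow> ennreal ((cmod (u n s - g s))\<^sup>2)"
          by (intro tendsto_intros elim)
        from lim_imp_Liminf[OF _ this] show ?case by simp
      qed
      also have "\<dots> \<le> liminf (\<lambda>k. \<integral>\<^sup>+ s. ennreal ((cmod (u n s - u (r k) s))\<^sup>2) \<partial>lebesgue)"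
        by (rule nn_integral_liminf) auto
      also have "\<dots> \<le> ennreal e"
      proof (rule Liminf_le)
        show "\<forall>\<^sub>F k in sequentially. (\<integral>\<^sup>+ s. ennreal ((cmod (u n s - u (r k) s))\<^sup>2) \<partial>lebesgue) \<le> ennreal e"
          using eventually_ge_at_top[of M]
        proof eventually_elim
          case (elim k)
          then have "sq_norm (\<lambda>s. u n s - u (r k) s) \<le> e" using n rk(1)[of k] by (intro M) auto
          then show ?case by (simp add: nn_integral_sq_norm[OF L2_diff[OF u u]] ennreal_leI)
        qed
      qed simp
      finally show ?thesis .
    qed
    then show ?thesis by blast
  qed
  obtain M where "(\<integral>\<^sup>+ s. ennreal ((cmod (u M s - g s))\<^sup>2) \<partial>lebesgue) \<le> ennreal 1"
    using est[of 1] by auto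
  then have "(\<lambda>s. u M s - g s) \<in> L2" unfolding L2_iff by (auto intro: le_less_trans)
  from L2_diff[OF u[of M] this] have "g \<in> L2" by simp
  moreover have "L2_tendsto u g"
    unfolding L2_tendsto_iff[OF u \<open>g \<in> L2\<close>]
  proof (rule LIMSEQ_I)
    fix e :: real assume e: "0 < e"
    obtain M where M: "\<And>n. n \<ge> M \<Longrightarrow> (\<integral>\<^sup>+ s. ennreal ((cmod (u n s - g s))\<^sup>2) \<partial>lebesgue) \<le> ennreal (e/2)"
      using est[of "e/2"] e by auto
    have "norm (sq_norm (\<lambda>s. u n s - g s) - 0) < e" if "n \<ge> M" for n
      using sq_norm_le_nn[OF L2_diff[OF u[of n] \<open>g \<in> L2\<close>] M[OF that]] e sq_norm_nonneg[of "\<lambda>s. u n s - g s"] by simp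
    then show "\<exists>no. \<forall>n\<ge>no. norm (sq_norm (\<lambda>s. u n s - g s) - 0) < e" by blast
  qed
  ultimately show ?thesis by blast
qed

section \<open>Fubini and changes of variables\<close>

lemma borel_measurable_cis [measurable]: "cis \<in> borel_measurable borel"
  by (intro borel_measurable_continuous_onI continuous_on_cis continuous_on_id)

lemma borel_measurable_cnj [measurable]: "cnj \<in> borel_measurable borel"
  by (intro borel_measurable_continuous_onI continuous_on_cnj continuous_on_id)

text \<open>
  Integrability on the product is always checked through the iterated integral of the modulus.
  Borel measurability is demanded on the product type, where continuity gives it directly.
\<close>

lemma integrable_lborel_pairI:
  fixes f :: "'a::euclidean_space \<Rightarrow> 'b::euclidean_space \<Rightarrow> complex"
  assumes [measurable]: "(\<lambda>(x, y). f x y) \<in> borel_measurable borel"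
    and "(\<integral>\<^sup>+ x. \<integral>\<^sup>+ y. ennreal (cmod (f x y)) \<partial>lborel \<partial>lborel) < \<infinity>"
  shows "integrable (lborel \<Otimes>\<^sub>M lborel) (\<lambda>(x, y). f x y)"
proof -
  have [measurable]: "(\<lambda>(x, y). f x y) \<in> borel_measurable (lborel \<Otimes>\<^sub>M lborel)"
    using assms(1) by (simp add: lborel_prod)
  have "(\<integral>\<^sup>+ x. \<integral>\<^sup>+ y. ennreal (cmod (f x y)) \<partial>lborel \<partial>lborel) =
      (\<integral>\<^sup>+ p. ennreal (cmod (case p of (x, y) \<Rightarrow> f x y)) \<partial>(lborel \<Otimes>\<^sub>M lborel))"
    by (subst lborel.nn_integral_fst[symmetric]) auto
  with assms(2) show ?thesis by (simp add: integrable_iff_bounded)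
qed

lemma norm_integral_le_nn_integral:
  fixes f :: "'a \<Rightarrow> complex"
  shows "ennreal (cmod (LINT x|M. f x)) \<le> (\<integral>\<^sup>+ x. ennreal (cmod (f x)) \<partial>M)"
  by (cases "integrable M f") (auto simp: not_integrable_integral_eq intro: integral_norm_bound_ennreal)

lemma Fubini_lborel:
  fixes f :: "'a::euclidean_space \<Rightarrow> 'b::euclidean_space \<Rightarrow> complex"
  assumes "(\<lambda>(x, y). f x y) \<in> borel_measurable borel"
    and "(\<integral>\<^sup>+ x. \<integral>\<^sup>+ y. ennreal (cmod (f x y)) \<partial>lborel \<partial>lborel) < \<infinity>"
  shows "(LINT x|lborel. LINT y|lborel. f x y) = (LINT y|lborel. LINT x|lborel. f x y)"
  by (rule lborel_pair.Fubini_integral[symmetric]) (rule integrable_lborel_pairI[OF assms])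

lemma integrable_iterated_lborel:
  fixes f :: "'a::euclidean_space \<Rightarrow> 'b::euclidean_space \<Rightarrow> complex"
  assumes "(\<lambda>(x, y). f x y) \<in> borel_measurable borel"
    and "(\<integral>\<^sup>+ x. \<integral>\<^sup>+ y. ennreal (cmod (f x y)) \<partial>lborel \<partial>lborel) < \<infinity>"
  shows "integrable lborel (\<lambda>y. LINT x|lborel. f x y)"
  by (rule lborel_pair.integrable_snd) (rule integrable_lborel_pairI[OF assms])

text \<open>
  The form of Fubini's theorem behind the multiplication formula: a bounded kernel such as
  \<open>cis (- 2 * pi * (x \<bullet> y))\<close> passes from one integrable function to another.
\<close>

lemma Fubini_bounded_kernel:
  fixes a :: "'a::euclidean_space \<Rightarrow> complex" and b :: "'b::euclidean_space \<Rightarrow> complex"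
  assumes a: "integrable lborel a" and b: "integrable lborel b"
    and k: "(\<lambda>(x, y). k x y) \<in> borel_measurable borel" "\<And>x y. cmod (k x y) \<le> 1"
  shows "(LINT y|lborel. (LINT x|lborel. a x * k x y) * b y) =
      (LINT x|lborel. a x * (LINT y|lborel. k x y * b y))"
proof -
  have [measurable]: "a \<in> borel_measurable borel" "b \<in> borel_measurable borel"
    using a b by (auto dest: borel_measurable_integrable)
  have [measurable]: "(\<lambda>(x, y). k x y) \<in> borel_measurable (borel \<Otimes>\<^sub>M borel)"
    using k(1) by (simp add: borel_prod)
  have "(\<lambda>(x, y). a x * k x y * b y) \<in> borel_measurable (borel \<Otimes>\<^sub>M borel)"
    by measurable
  then have m: "(\<lambda>(x, y). a x * k x y * b y) \<in> borel_measurable borel"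
    by (simp add: borel_prod)
  have "(\<integral>\<^sup>+ x. \<integral>\<^sup>+ y. ennreal (cmod (a x * k x y * b y)) \<partial>lborel \<partial>lborel)
      \<le> (\<integral>\<^sup>+ x. \<integral>\<^sup>+ y. ennreal (cmod (a x)) * ennreal (cmod (b y)) \<partial>lborel \<partial>lborel)"
  proof (intro nn_integral_mono)
    fix x y
    have "cmod (a x) * cmod (k x y) * cmod (b y) \<le> cmod (a x) * 1 * cmod (b y)"
      by (intro mult_right_mono mult_left_mono k(2)) auto
    then show "ennreal (cmod (a x * k x y * b y)) \<le> ennreal (cmod (a x)) * ennreal (cmod (b y))"
      by (simp add: norm_mult ennreal_leI flip: ennreal_mult)
  qed
  also have "\<dots> = (\<integral>\<^sup>+ x. ennreal (cmod (a x)) \<partial>lborel) * (\<integral>\<^sup>+ y. ennreal (cmod (b y)) \<partial>lborel)"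
    by (simp add: nn_integral_cmult nn_integral_multc)
  also have "\<dots> < \<infinity>"
    using a b by (simp add: integrable_iff_bounded ennreal_mult_less_top)
  finally have fin: "(\<integral>\<^sup>+ x. \<integral>\<^sup>+ y. ennreal (cmod (a x * k x y * b y)) \<partial>lborel \<partial>lborel) < \<infinity>" .
  show ?thesis
    using Fubini_lborel[OF m fin, symmetric]
    by (simp add: mult.assoc flip: integral_mult_left_zero integral_mult_right_zero)
qed

lemma lborel_integral_affine:
  fixes f :: "'a::euclidean_space \<Rightarrow> complex"
  assumes [measurable]: "f \<in> borel_measurable borel" and c: "c \<noteq> 0"
  shows "(LINT x|lborel. f x) = complex_of_real (\<bar>c\<bar> ^ DIM('a)) * (LINT x|lborel. f (t + c *\<^sub>R x))"
  by (subst lborel_affine[OF c, of t]) (simp add: integral_density integral_distr scaleR_conv_of_real)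

lemma lborel_nn_integral_affine:
  fixes f :: "'a::euclidean_space \<Rightarrow> ennreal"
  assumes [measurable]: "f \<in> borel_measurable borel" and c: "c \<noteq> 0"
  shows "(\<integral>\<^sup>+ x. f x \<partial>lborel) = ennreal (\<bar>c\<bar> ^ DIM('a)) * (\<integral>\<^sup>+ x. f (t + c *\<^sub>R x) \<partial>lborel)"
  by (subst lborel_affine[OF c, of t]) (simp add: nn_integral_density nn_integral_distr nn_integral_cmult)

lemma lborel_nn_integral_shift:
  fixes f :: "'a::euclidean_space \<Rightarrow> ennreal"
  assumes "f \<in> borel_measurable borel"
  shows "(\<integral>\<^sup>+ x. f (x + t) \<partial>lborel) = (\<integral>\<^sup>+ x. f x \<partial>lborel)"
  using lborel_nn_integral_affine[OF assms, of 1 t] by (simp add: add.commute)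

section \<open>The Gaussian is its own Fourier transform\<close>

definition gauss :: "'a::euclidean_space \<Rightarrow> real" where
  "gauss x = exp (- pi * (norm x)\<^sup>2)"

lemma borel_measurable_gauss [measurable]: "gauss \<in> borel_measurable borel"
  unfolding gauss_def[abs_def] by measurable

lemma gauss_pos: "0 < gauss x" and gauss_le_1: "gauss x \<le> 1" and gauss_minus: "gauss (- x) = gauss x"
  by (auto simp: gauss_def)

text \<open>
  In one dimension this is the characteristic function of the standard normal distribution, rescaled
  by \<open>sqrt (2 * pi)\<close> to match the normalisation of \<open>fourier_L1\<close>.
\<close>

lemma gauss_fourier_1d:
  fixes a :: real
  shows "integrable lborel (\<lambda>t::real. exp (- pi * t\<^sup>2) * cis (- 2 * pi * (t * a)))"
    and "(LINT t|lborel. exp (- pi * t\<^sup>2) * cis (- 2 * pi * (t * a))) = complex_of_real (exp (- pi * a\<^sup>2))"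
proof -
  let ?r = "sqrt (2 * pi)"
  let ?g = "\<lambda>x. std_normal_density x *\<^sub>R iexp ((- ?r * a) * x)"
  have r: "?r \<noteq> 0" and ra: "\<bar>?r\<bar> = ?r" by simp_all
  have eq: "?r *\<^sub>R ?g (0 + ?r * t) = exp (- pi * t\<^sup>2) * cis (- 2 * pi * (t * a))" for t
    by (simp add: std_normal_density_def power_mult_distrib cis_conv_exp scaleR_conv_of_real
        real_sqrt_mult_self algebra_simps flip: of_real_mult)
  have int: "integrable lborel ?g"
    by (rule Bochner_Integration.integrable_bound[OF integrable_normal_moment[of 1 0 0]]) auto
  have "integrable lborel (\<lambda>t. ?r *\<^sub>R ?g (0 + ?r * t))"
    by (rule integrable_scaleR_right) (rule lborel_integrable_real_affine[OF int r])
  then show "integrable lborel (\<lambda>t::real. exp (- pi * t\<^sup>2) * cis (- 2 * pi * (t * a)))"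
    unfolding eq .
  have "(LINT t|lborel. exp (- pi * t\<^sup>2) * cis (- 2 * pi * (t * a))) = ?r *\<^sub>R (LINT t|lborel. ?g (0 + ?r * t))"
    unfolding eq[symmetric] by (rule integral_scaleR_right)
  also have "\<dots> = (LINT x|lborel. ?g x)"
    using lborel_integral_real_affine[OF r, of ?g 0] unfolding ra by (rule sym)
  also have "\<dots> = char std_normal_distribution (- ?r * a)"
    unfolding char_def by (subst integral_density) auto
  also have "\<dots> = exp (- pi * a\<^sup>2)"
    by (simp add: char_std_normal_distribution power_mult_distrib)
  finally show "(LINT t|lborel. exp (- pi * t\<^sup>2) * cis (- 2 * pi * (t * a))) = complex_of_real (exp (- pi * a\<^sup>2))" .
qed

text \<open>
  Lebesgue measure on a Euclidean space is the image of a product of one-dimensional measures, so that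
  integrals of products of functions of separate coordinates factorise.
\<close>

lemma lborel_integral_prod:
  fixes f :: "'a::euclidean_space \<Rightarrow> real \<Rightarrow> complex"
  assumes f: "\<And>b. b \<in> Basis \<Longrightarrow> integrable lborel (f b)"
  shows "integrable lborel (\<lambda>x::'a. \<Prod>b\<in>Basis. f b (x \<bullet> b))"
    and "(LINT x|lborel. (\<Prod>b\<in>Basis. f b (x \<bullet> b))) = (\<Prod>b\<in>Basis. (LINT t|lborel. f b t))"
proof -
  interpret product_sigma_finite "\<lambda>b::'a. lborel :: real measure" ..
  have [measurable]: "b \<in> Basis \<Longrightarrow> f b \<in> borel_measurable borel" for b
    using borel_measurable_integrable[OF f] by simp
  let ?T = "\<lambda>g::'a \<Rightarrow> real. \<Sum>b\<in>Basis. g b *\<^sub>R b"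
  have T[measurable]: "?T \<in> measurable (\<Pi>\<^sub>M b\<in>Basis. lborel) borel" by measurable
  have m[measurable]: "(\<lambda>x::'a. \<Prod>b\<in>Basis. f b (x \<bullet> b)) \<in> borel_measurable borel" by measurable
  have eq: "(\<Prod>b\<in>Basis. f b (?T g \<bullet> b)) = (\<Prod>b\<in>Basis. f b (g b))" for g
    by (intro prod.cong refl) simp
  show "integrable lborel (\<lambda>x::'a. \<Prod>b\<in>Basis. f b (x \<bullet> b))"
    by (subst lborel_eq, subst integrable_distr_eq[OF T m])
       (simp add: eq product_integrable_prod[OF finite_Basis f])
  show "(LINT x|lborel. (\<Prod>b\<in>Basis. f b (x \<bullet> b))) = (\<Prod>b\<in>Basis. (LINT t|lborel. f b t))"
    by (subst lborel_eq, subst integral_distr[OF T m])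
       (simp add: eq product_integral_prod[OF finite_Basis f])
qed

lemma gauss_fourier:
  fixes \<xi> :: "'a::euclidean_space"
  shows "integrable lborel (\<lambda>x. gauss x * cis (- 2 * pi * (x \<bullet> \<xi>)))"
    and "(LINT x|lborel. gauss x * cis (- 2 * pi * (x \<bullet> \<xi>))) = complex_of_real (gauss \<xi>)"
proof -
  define f where "f b t = exp (- pi * t\<^sup>2) * cis (- 2 * pi * (t * (\<xi> \<bullet> b)))" for b :: 'a and t :: real
  have gp: "gauss x = (\<Prod>b\<in>Basis. exp (- pi * (x \<bullet> b)\<^sup>2))" for x :: 'a
    unfolding gauss_def power2_norm_eq_inner
    by (subst euclidean_inner) (simp add: sum_distrib_left exp_sum power2_eq_square)
  have cp: "cis (- 2 * pi * (x \<bullet> \<xi>)) = (\<Prod>b\<in>Basis. cis (- 2 * pi * ((x \<bullet> b) * (\<xi> \<bullet> b))))" for x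
    by (subst euclidean_inner) (simp add: sum_distrib_left cis_conv_exp exp_sum)
  have eq: "gauss x * cis (- 2 * pi * (x \<bullet> \<xi>)) = (\<Prod>b\<in>Basis. f b (x \<bullet> b))" for x
    unfolding f_def prod.distrib gp cp by simp
  have int: "integrable lborel (f b)" for b unfolding f_def by (rule gauss_fourier_1d)
  show "integrable lborel (\<lambda>x. gauss x * cis (- 2 * pi * (x \<bullet> \<xi>)))"
    unfolding eq by (rule lborel_integral_prod(1)[OF int])
  show "(LINT x|lborel. gauss x * cis (- 2 * pi * (x \<bullet> \<xi>))) = complex_of_real (gauss \<xi>)"
    unfolding eq lborel_integral_prod(2)[OF int] unfolding f_def gauss_fourier_1d gp by simp
qed

lemma gauss_integrable: "integrable lborel (gauss :: 'a::euclidean_space \<Rightarrow> real)"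
  and gauss_integral: "(LINT x|lborel. gauss (x::'a)) = 1"
proof -
  have "integrable lborel (\<lambda>x. complex_of_real (gauss (x::'a)))"
    using gauss_fourier(1)[of "0::'a"] by simp
  then show "integrable lborel (gauss :: 'a \<Rightarrow> real)"
    using integrable_Re[of lborel "\<lambda>x. complex_of_real (gauss (x::'a))"] by simp
  have "complex_of_real (LINT x|lborel. gauss (x::'a)) = 1"
    using gauss_fourier(2)[of "0::'a"] by (simp add: gauss_def[of 0])
  then show "(LINT x|lborel. gauss (x::'a)) = 1" by simp
qed

lemma gauss_nn_integral: "(\<integral>\<^sup>+ x. ennreal (gauss (x::'a::euclidean_space)) \<partial>lborel) = 1"
  by (subst nn_integral_eq_integral[OF gauss_integrable]) (simp_all add: gauss_integral gauss_pos less_imp_le)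

lemma gauss_scaled_integrable:
  assumes d: "0 < \<delta>"
  shows "integrable lborel (\<lambda>\<xi>::'a::euclidean_space. gauss (\<delta> *\<^sub>R \<xi>))"
proof -
  have "(\<integral>\<^sup>+ \<xi>. ennreal (gauss (\<delta> *\<^sub>R (0 + (1/\<delta>) *\<^sub>R (\<xi>::'a)))) \<partial>lborel) = 1"
    using d gauss_nn_integral[where 'a='a] by simp
  with lborel_nn_integral_affine[of "\<lambda>\<xi>. ennreal (gauss (\<delta> *\<^sub>R \<xi>))" "1/\<delta>" "0::'a"]
  have "(\<integral>\<^sup>+ \<xi>. ennreal (gauss (\<delta> *\<^sub>R \<xi>)) \<partial>(lborel::'a measure)) < \<infinity>"
    using d by simp
  then show ?thesis
    by (simp add: integrable_iff_bounded gauss_pos less_imp_le)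
qed

lemma gauss_scaled_fourier:
  fixes x :: "'a::euclidean_space"
  assumes "0 < \<delta>"
  shows "(LINT \<xi>|lborel. gauss (\<delta> *\<^sub>R \<xi>) * cis (- 2 * pi * (x \<bullet> \<xi>))) =
      complex_of_real (gauss ((1/\<delta>) *\<^sub>R x)) / complex_of_real (\<delta> ^ DIM('a))"
proof -
  have "(LINT \<xi>|lborel. gauss (\<delta> *\<^sub>R \<xi>) * cis (- 2 * pi * (x \<bullet> \<xi>))) =
      complex_of_real (\<bar>1/\<delta>\<bar> ^ DIM('a)) * (LINT \<xi>|lborel. gauss (\<delta> *\<^sub>R (0 + (1/\<delta>) *\<^sub>R \<xi>)) * cis (- 2 * pi * (x \<bullet> (0 + (1/\<delta>) *\<^sub>R \<xi>))))"
    using assms by (intro lborel_integral_affine) auto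
  also have "\<dots> = (1/\<delta>) ^ DIM('a) * (LINT \<xi>|lborel. gauss \<xi> * cis (- 2 * pi * (\<xi> \<bullet> ((1/\<delta>) *\<^sub>R x))))"
    using assms by (simp add: inner_commute)
  also have "\<dots> = complex_of_real (gauss ((1/\<delta>) *\<^sub>R x)) / complex_of_real (\<delta> ^ DIM('a))"
    unfolding gauss_fourier by (simp add: field_simps power_one_over)
  finally show ?thesis .
qed

section \<open>Plancherel's theorem for functions in both spaces\<close>

text \<open>
  Fubini's theorem needs Borel functions, since \<open>w (t - s)\<close> may fail to be measurable on the product
  when \<open>w\<close> is only Lebesgue measurable. Changing a function on a null set repairs this and
  leaves all the integrals of interest unchanged.
\<close>

lemma borel_representative:
  fixes f :: "'a::euclidean_space \<Rightarrow> complex"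
  assumes "f \<in> borel_measurable lebesgue"
  obtains g where "g \<in> borel_measurable borel" "AE s in lebesgue. f s = g s" "AE s in lborel. f s = g s"
proof -
  have Re: "(\<lambda>s. Re (f s)) \<in> borel_measurable lebesgue" and Im: "(\<lambda>s. Im (f s)) \<in> borel_measurable lebesgue"
    using assms by measurable
  obtain r where [measurable]: "r \<in> borel_measurable lborel" and r: "AE s in lborel. Re (f s) = r s"
    using completion_ex_borel_measurable_real[OF Re] by blast
  obtain i where [measurable]: "i \<in> borel_measurable lborel" and i: "AE s in lborel. Im (f s) = i s"
    using completion_ex_borel_measurable_real[OF Im] by blast
  have eq: "AE s in lborel. f s = Complex (r s) (i s)"
    using r i by eventually_elim (simp add: complex_eq_iff)
  have "(\<lambda>s. complex_of_real (r s) + \<i> * complex_of_real (i s)) \<in> borel_measurable lborel"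
    by measurable
  then have "(\<lambda>s. Complex (r s) (i s)) \<in> borel_measurable borel"
    by (simp add: Complex_eq)
  from that[OF this AE_completion[OF eq] eq] show thesis .
qed

lemma fourier_L1_lborel:
  fixes f :: "'a::euclidean_space \<Rightarrow> complex"
  assumes [measurable]: "f \<in> borel_measurable borel"
  shows "fourier_L1 f \<xi> = (LINT s|lborel. f s * cis (- 2 * pi * (s \<bullet> \<xi>)))"
  unfolding fourier_L1_def by (rule integral_completion) measurable

lemma fourier_L1_cong_AE:
  fixes f g :: "'a::euclidean_space \<Rightarrow> complex"
  assumes "f \<in> borel_measurable lebesgue" "g \<in> borel_measurable lebesgue" "AE s in lebesgue. f s = g s"
  shows "fourier_L1 f = fourier_L1 g"
proof
  fix \<xi> :: 'a
  have [measurable]: "(\<lambda>s. cis (- 2 * pi * (s \<bullet> \<xi>))) \<in> borel_measurable lebesgue"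
    by (rule measurable_completion) measurable
  have m: "(\<lambda>s. f s * cis (- 2 * pi * (s \<bullet> \<xi>))) \<in> borel_measurable lebesgue"
    "(\<lambda>s. g s * cis (- 2 * pi * (s \<bullet> \<xi>))) \<in> borel_measurable lebesgue"
    using assms(1,2) by measurable
  show "fourier_L1 f \<xi> = fourier_L1 g \<xi>"
    unfolding fourier_L1_def by (rule integral_cong_AE[OF m]) (use assms(3) in auto)
qed

lemma borel_representative_integral:
  fixes h :: "'a::euclidean_space \<Rightarrow> complex"
  assumes "integrable lebesgue h"
  obtains g where "g \<in> borel_measurable borel" "integrable lborel g"
    "AE s in lebesgue. h s = g s" "fourier_L1 h = fourier_L1 g"
proof -
  have hm: "h \<in> borel_measurable lebesgue" using assms by auto
  obtain g where g: "g \<in> borel_measurable borel" "AE s in lebesgue. h s = g s"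
    using borel_representative[OF hm] by blast
  have gl: "g \<in> borel_measurable lebesgue" using g(1) by (intro measurable_completion) simp
  have "integrable lebesgue g"
    by (rule integrable_cong_AE_imp[OF assms gl]) (use g(2) in auto)
  then have "integrable lborel g" using g(1) by (simp add: integrable_completion)
  from that[OF g(1) this g(2) fourier_L1_cong_AE[OF hm gl g(2)]] show thesis .
qed

lemma borel_measurable_fourier_L1_borel:
  fixes f :: "'a::euclidean_space \<Rightarrow> complex"
  assumes [measurable]: "f \<in> borel_measurable borel"
  shows "fourier_L1 f \<in> borel_measurable borel"
proof -
  have "(\<lambda>\<xi>. LINT s|lborel. f s * cis (- 2 * pi * (s \<bullet> \<xi>))) \<in> borel_measurable borel"
    by measurable
  then show ?thesis by (simp add: fourier_L1_lborel[OF assms, abs_def])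
qed

lemma integrable_mult_cis:
  fixes f :: "'a::euclidean_space \<Rightarrow> complex"
  assumes "integrable lebesgue f"
  shows "integrable lebesgue (\<lambda>s. f s * cis (c * (s \<bullet> \<xi>)))"
proof -
  have [measurable]: "f \<in> borel_measurable lebesgue" using assms by auto
  have [measurable]: "(\<lambda>s. cis (c * (s \<bullet> \<xi>))) \<in> borel_measurable lebesgue"
    by (rule measurable_completion) measurable
  show ?thesis
    by (rule Bochner_Integration.integrable_bound[OF assms]) (auto simp: norm_mult)
qed

lemma fourier_L1_bound:
  assumes "integrable lebesgue f"
  shows "cmod (fourier_L1 f \<xi>) \<le> (LINT s|lebesgue. cmod (f s))"
  unfolding fourier_L1_def
  by (rule order_trans[OF integral_norm_bound]) (simp add: norm_mult)

lemma fourier_L1_bound_lborel: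
  assumes "f \<in> borel_measurable borel"
  shows "cmod (fourier_L1 f \<xi>) \<le> (LINT s|lborel. cmod (f s))"
  unfolding fourier_L1_lborel[OF assms]
  by (rule order_trans[OF integral_norm_bound]) (simp add: norm_mult)

lemma fourier_L1_diff:
  assumes "integrable lebesgue f" "integrable lebesgue g"
  shows "fourier_L1 (\<lambda>s. f s - g s) \<xi> = fourier_L1 f \<xi> - fourier_L1 g \<xi>"
  unfolding fourier_L1_def left_diff_distrib
  by (rule Bochner_Integration.integral_diff[OF integrable_mult_cis[OF assms(1)] integrable_mult_cis[OF assms(2)]])

text \<open>
  The heart of Plancherel's theorem. The energy of the transform need not converge absolutely as a
  triple integral, but with the Gaussian weight Fubini's theorem applies: the \<open>\<xi>\<close>-integral becomes
  a rescaled Gaussian in \<open>s - t\<close>, which the substitution \<open>t = s + \<delta> z\<close> turns into an average of \<open>f\<close>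
  around \<open>s\<close>. As \<open>\<delta>\<close> tends to 0 the left side tends to the energy of the transform and, for nice \<open>f\<close>,
  the right side to that of \<open>f\<close>.
\<close>

lemma gauss_regularized_energy:
  fixes f :: "'a::euclidean_space \<Rightarrow> complex"
  assumes f: "f \<in> borel_measurable borel" "integrable lborel f" and d: "0 < \<delta>"
  shows "(LINT \<xi>|lborel. complex_of_real ((cmod (fourier_L1 f \<xi>))\<^sup>2 * gauss (\<delta> *\<^sub>R \<xi>))) =
    (LINT s|lborel. f s * (LINT z|lborel. cnj (f (s + \<delta> *\<^sub>R z)) * gauss z))"
proof -
  note [measurable] = f(1) borel_measurable_fourier_L1_borel[OF f(1)]
  let ?e = "\<lambda>s \<xi>. cis (- 2 * pi * (s \<bullet> \<xi>))"
  have fc: "integrable lborel (\<lambda>t. cnj (f t))" using f(2) by simp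
  have gd: "integrable lborel (\<lambda>\<xi>. complex_of_real (gauss (\<delta> *\<^sub>R \<xi>)))"
    by (rule integrable_of_real[OF gauss_scaled_integrable[OF d]])
  have bnd: "cmod (fourier_L1 f \<xi>) \<le> (LINT s|lborel. cmod (f s))" for \<xi>
    by (rule fourier_L1_bound_lborel[OF f(1)])
  have b: "integrable lborel (\<lambda>\<xi>. cnj (fourier_L1 f \<xi>) * gauss (\<delta> *\<^sub>R \<xi>))"
    by (rule Bochner_Integration.integrable_bound[OF integrable_mult_right[OF gd, of "LINT s|lborel. cmod (f s)"]])
       (auto simp: norm_mult intro!: mult_right_mono AE_I2 order_trans[OF bnd])
  have kernel: "(LINT \<xi>|lborel. ?e x \<xi> * gauss (\<delta> *\<^sub>R \<xi>)) =
      complex_of_real (gauss ((1/\<delta>) *\<^sub>R x)) / complex_of_real (\<delta> ^ DIM('a))" for x :: 'a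
    by (subst mult.commute) (rule gauss_scaled_fourier[OF d])
  have inner: "(LINT \<xi>|lborel. ?e s \<xi> * (cnj (fourier_L1 f \<xi>) * gauss (\<delta> *\<^sub>R \<xi>))) =
      (LINT z|lborel. cnj (f (s + \<delta> *\<^sub>R z)) * gauss z)" for s
  proof -
    have "(LINT \<xi>|lborel. ?e s \<xi> * (cnj (fourier_L1 f \<xi>) * gauss (\<delta> *\<^sub>R \<xi>))) =
        (LINT \<xi>|lborel. (LINT t|lborel. cnj (f t) * ?e (s - t) \<xi>) * gauss (\<delta> *\<^sub>R \<xi>))"
    proof (intro Bochner_Integration.integral_cong refl)
      fix \<xi>
      have "?e s \<xi> * cnj (fourier_L1 f \<xi>) = (LINT t|lborel. ?e s \<xi> * cnj (f t * ?e t \<xi>))"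
        by (simp only: fourier_L1_lborel[OF f(1)] Bochner_Integration.integral_cnj integral_mult_right_zero)
      also have "\<dots> = (LINT t|lborel. cnj (f t) * ?e (s - t) \<xi>)"
        by (intro Bochner_Integration.integral_cong refl)
           (simp add: cis_cnj cis_mult inner_diff_left algebra_simps)
      finally show "?e s \<xi> * (cnj (fourier_L1 f \<xi>) * gauss (\<delta> *\<^sub>R \<xi>)) =
          (LINT t|lborel. cnj (f t) * ?e (s - t) \<xi>) * gauss (\<delta> *\<^sub>R \<xi>)"
        by (simp add: mult.assoc[symmetric])
    qed
    also have "\<dots> = (LINT t|lborel. cnj (f t) * (LINT \<xi>|lborel. ?e (s - t) \<xi> * gauss (\<delta> *\<^sub>R \<xi>)))"
      by (rule Fubini_bounded_kernel[OF fc gd])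
         (auto simp: split_def intro!: borel_measurable_continuous_onI continuous_on_cis continuous_intros)
    also have "\<dots> = (LINT t|lborel. cnj (f t) * (complex_of_real (gauss ((1/\<delta>) *\<^sub>R (s - t))) / complex_of_real (\<delta> ^ DIM('a))))"
      by (simp only: kernel)
    also have "\<dots> = complex_of_real (\<bar>\<delta>\<bar> ^ DIM('a)) * (LINT z|lborel. cnj (f (s + \<delta> *\<^sub>R z)) *
        (complex_of_real (gauss ((1/\<delta>) *\<^sub>R (s - (s + \<delta> *\<^sub>R z)))) / complex_of_real (\<delta> ^ DIM('a))))"
      using d by (intro lborel_integral_affine) auto
    also have "\<dots> = (LINT z|lborel. cnj (f (s + \<delta> *\<^sub>R z)) * gauss z)"
      using d by (simp add: gauss_minus)
    finally show ?thesis .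
  qed
  have "(LINT \<xi>|lborel. complex_of_real ((cmod (fourier_L1 f \<xi>))\<^sup>2 * gauss (\<delta> *\<^sub>R \<xi>))) =
      (LINT \<xi>|lborel. (LINT s|lborel. f s * ?e s \<xi>) * (cnj (fourier_L1 f \<xi>) * gauss (\<delta> *\<^sub>R \<xi>)))"
    by (simp add: complex_norm_square mult.assoc fourier_L1_lborel[OF f(1)] del: of_real_power)
  also have "\<dots> = (LINT s|lborel. f s * (LINT \<xi>|lborel. ?e s \<xi> * (cnj (fourier_L1 f \<xi>) * gauss (\<delta> *\<^sub>R \<xi>))))"
    by (rule Fubini_bounded_kernel[OF f(2) b])
       (auto simp: split_def intro!: borel_measurable_continuous_onI continuous_on_cis continuous_intros)
  finally show ?thesis unfolding inner .
qed

text \<open>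
  From \<open>2 a b \<le> a\<^sup>2 + b\<^sup>2\<close>, translation invariance, and the fact that the Gaussian has integral 1.
\<close>

lemma nn_integral_shift_square:
  fixes f :: "'a::euclidean_space \<Rightarrow> complex"
  assumes [measurable]: "f \<in> borel_measurable borel"
  shows "(\<integral>\<^sup>+ s. \<integral>\<^sup>+ z. ennreal (cmod (f s) * (cmod (f (s + \<delta> *\<^sub>R z)) * gauss z)) \<partial>lborel \<partial>lborel)
     \<le> (\<integral>\<^sup>+ s. ennreal ((cmod (f s))\<^sup>2) \<partial>lborel)"
proof -
  let ?I = "\<integral>\<^sup>+ s. ennreal ((cmod (f s))\<^sup>2) \<partial>lborel"
  let ?L = "\<integral>\<^sup>+ s. \<integral>\<^sup>+ z. ennreal (cmod (f s) * (cmod (f (s + \<delta> *\<^sub>R z)) * gauss z)) \<partial>lborel \<partial>lborel"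
  have "2 * ?L = (\<integral>\<^sup>+ s. \<integral>\<^sup>+ z. 2 * ennreal (cmod (f s) * (cmod (f (s + \<delta> *\<^sub>R z)) * gauss z)) \<partial>lborel \<partial>lborel)"
    by (simp add: nn_integral_cmult)
  also have "\<dots> \<le> (\<integral>\<^sup>+ s. \<integral>\<^sup>+ z. ennreal ((cmod (f s))\<^sup>2) * ennreal (gauss z) +
      ennreal ((cmod (f (s + \<delta> *\<^sub>R z)))\<^sup>2) * ennreal (gauss z) \<partial>lborel \<partial>lborel)"
  proof (intro nn_integral_mono)
    fix s z
    have "2 * (cmod (f s) * (cmod (f (s + \<delta> *\<^sub>R z)) * gauss z)) = (2 * cmod (f s) * cmod (f (s + \<delta> *\<^sub>R z))) * gauss z"
      by simp
    also have "\<dots> \<le> ((cmod (f s))\<^sup>2 + (cmod (f (s + \<delta> *\<^sub>R z)))\<^sup>2) * gauss z"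
      by (intro mult_right_mono sum_squares_bound) (simp add: gauss_pos less_imp_le)
    finally have "ennreal (2 * (cmod (f s) * (cmod (f (s + \<delta> *\<^sub>R z)) * gauss z))) \<le>
      ennreal ((cmod (f s))\<^sup>2 * gauss z + (cmod (f (s + \<delta> *\<^sub>R z)))\<^sup>2 * gauss z)"
      by (intro ennreal_leI) (simp add: algebra_simps)
    also have "\<dots> = ennreal ((cmod (f s))\<^sup>2) * ennreal (gauss z) +
      ennreal ((cmod (f (s + \<delta> *\<^sub>R z)))\<^sup>2) * ennreal (gauss z)"
      by (simp add: gauss_pos less_imp_le ennreal_plus flip: ennreal_mult)
    finally show "2 * ennreal (cmod (f s) * (cmod (f (s + \<delta> *\<^sub>R z)) * gauss z)) \<le> ennreal ((cmod (f s))\<^sup>2) * ennreal (gauss z) +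
      ennreal ((cmod (f (s + \<delta> *\<^sub>R z)))\<^sup>2) * ennreal (gauss z)"
      by (simp add: ennreal_mult gauss_pos less_imp_le)
  qed
  also have "\<dots> = (\<integral>\<^sup>+ s. \<integral>\<^sup>+ z. ennreal ((cmod (f s))\<^sup>2) * ennreal (gauss (z::'a)) \<partial>lborel \<partial>lborel) +
      (\<integral>\<^sup>+ s. \<integral>\<^sup>+ z. ennreal ((cmod (f (s + \<delta> *\<^sub>R z)))\<^sup>2) * ennreal (gauss z) \<partial>lborel \<partial>lborel)"
  proof -
    have inner: "(\<integral>\<^sup>+ z. ennreal ((cmod (f s))\<^sup>2) * ennreal (gauss z) + ennreal ((cmod (f (s + \<delta> *\<^sub>R z)))\<^sup>2) * ennreal (gauss z) \<partial>lborel) =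
        (\<integral>\<^sup>+ z. ennreal ((cmod (f s))\<^sup>2) * ennreal (gauss (z::'a)) \<partial>lborel) +
        (\<integral>\<^sup>+ z. ennreal ((cmod (f (s + \<delta> *\<^sub>R z)))\<^sup>2) * ennreal (gauss z) \<partial>lborel)" for s
      by (rule nn_integral_add) measurable
    show ?thesis unfolding inner by (rule nn_integral_add) measurable
  qed
  also have "(\<integral>\<^sup>+ s. \<integral>\<^sup>+ z. ennreal ((cmod (f s))\<^sup>2) * ennreal (gauss (z::'a)) \<partial>lborel \<partial>lborel) = ?I"
    by (simp add: nn_integral_cmult gauss_nn_integral)
  also have "(\<integral>\<^sup>+ s. \<integral>\<^sup>+ z. ennreal ((cmod (f (s + \<delta> *\<^sub>R z)))\<^sup>2) * ennreal (gauss z) \<partial>lborel \<partial>lborel) =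
      (\<integral>\<^sup>+ z. \<integral>\<^sup>+ s. ennreal ((cmod (f (s + \<delta> *\<^sub>R z)))\<^sup>2) * ennreal (gauss z) \<partial>lborel \<partial>lborel)"
    by (rule lborel_pair.Fubini') measurable
  also have "\<dots> = (\<integral>\<^sup>+ z. ?I * ennreal (gauss (z::'a)) \<partial>lborel)"
    by (intro nn_integral_cong) (simp add: nn_integral_multc lborel_nn_integral_shift[of "\<lambda>s. ennreal ((cmod (f s))\<^sup>2)"])
  also have "\<dots> = ?I"
    by (simp add: nn_integral_cmult gauss_nn_integral)
  also have "?I + ?I = 2 * ?I" by (simp add: mult_2)
  finally show ?thesis
    by (simp add: ennreal_mult_le_mult_iff)
qed

text \<open>
  The regularised energies are bounded by the energy of \<open>f\<close>, uniformly in \<open>\<delta>\<close>, and Fatou's lemma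
  removes the weight. This half of Plancherel's theorem holds before any density argument and makes
  one possible: it shows that the transform is continuous for the \<open>L\<^sup>2\<close> distance.
\<close>

lemma fourier_L1_contraction_borel:
  fixes f :: "'a::euclidean_space \<Rightarrow> complex"
  assumes f: "f \<in> borel_measurable borel" "integrable lborel f"
  shows "(\<integral>\<^sup>+ \<xi>. ennreal ((cmod (fourier_L1 f \<xi>))\<^sup>2) \<partial>lborel) \<le> (\<integral>\<^sup>+ s. ennreal ((cmod (f s))\<^sup>2) \<partial>lborel)"
  (is "_ \<le> ?I")
proof (cases "?I = \<infinity>")
  case False
  note [measurable] = f(1) borel_measurable_fourier_L1_borel[OF f(1)]
  define \<delta> where "\<delta> n = 1 / real (Suc n)" for n
  have d: "0 < \<delta> n" for n by (simp add: \<delta>_def)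
  have d0: "\<delta> \<longlonglongrightarrow> 0" unfolding \<delta>_def by (rule lim_1_over_n[THEN LIMSEQ_Suc])
  have le: "(\<integral>\<^sup>+ \<xi>. ennreal ((cmod (fourier_L1 f \<xi>))\<^sup>2 * gauss (\<delta> n *\<^sub>R \<xi>)) \<partial>lborel) \<le> ?I" for n
  proof -
    have i: "integrable lborel (\<lambda>\<xi>. (cmod (fourier_L1 f \<xi>))\<^sup>2 * gauss (\<delta> n *\<^sub>R \<xi>))"
      by (rule Bochner_Integration.integrable_bound[OF integrable_mult_right[OF gauss_scaled_integrable[OF d[of n]],
            of "(LINT s|lborel. cmod (f s))\<^sup>2"]])
         (auto simp: gauss_pos less_imp_le intro!: mult_right_mono AE_I2 power_mono fourier_L1_bound_lborel f)
    have "(\<integral>\<^sup>+ \<xi>. ennreal ((cmod (fourier_L1 f \<xi>))\<^sup>2 * gauss (\<delta> n *\<^sub>R \<xi>)) \<partial>lborel) =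
        ennreal (LINT \<xi>|lborel. (cmod (fourier_L1 f \<xi>))\<^sup>2 * gauss (\<delta> n *\<^sub>R \<xi>))"
      by (rule nn_integral_eq_integral[OF i]) (simp add: gauss_pos less_imp_le)
    also have "\<dots> = ennreal (cmod (LINT \<xi>|lborel. complex_of_real ((cmod (fourier_L1 f \<xi>))\<^sup>2 * gauss (\<delta> n *\<^sub>R \<xi>))))"
      unfolding integral_complex_of_real norm_of_real
      by (simp add: integral_nonneg_AE gauss_pos less_imp_le)
    also have "\<dots> = ennreal (cmod (LINT s|lborel. f s * (LINT z|lborel. cnj (f (s + \<delta> n *\<^sub>R z)) * gauss z)))"
      unfolding gauss_regularized_energy[OF f d] ..
    also have "\<dots> \<le> (\<integral>\<^sup>+ s. ennreal (cmod (f s * (LINT z|lborel. cnj (f (s + \<delta> n *\<^sub>R z)) * gauss z))) \<partial>lborel)"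
      by (rule norm_integral_le_nn_integral)
    also have "\<dots> \<le> (\<integral>\<^sup>+ s. \<integral>\<^sup>+ z. ennreal (cmod (f s) * (cmod (f (s + \<delta> n *\<^sub>R z)) * gauss z)) \<partial>lborel \<partial>lborel)"
    proof (rule nn_integral_mono)
      fix s
      have "ennreal (cmod (f s * (LINT z|lborel. cnj (f (s + \<delta> n *\<^sub>R z)) * gauss z))) =
          ennreal (cmod (LINT z|lborel. f s * (cnj (f (s + \<delta> n *\<^sub>R z)) * gauss z)))"
        by simp
      also have "\<dots> \<le> (\<integral>\<^sup>+ z. ennreal (cmod (f s * (cnj (f (s + \<delta> n *\<^sub>R z)) * gauss z))) \<partial>lborel)"
        by (rule norm_integral_le_nn_integral)
      finally show "ennreal (cmod (f s * (LINT z|lborel. cnj (f (s + \<delta> n *\<^sub>R z)) * gauss z))) \<le>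
          (\<integral>\<^sup>+ z. ennreal (cmod (f s) * (cmod (f (s + \<delta> n *\<^sub>R z)) * gauss z)) \<partial>lborel)"
        by (simp add: norm_mult gauss_pos less_imp_le)
    qed
    also have "\<dots> \<le> ?I" by (rule nn_integral_shift_square[OF f(1)])
    finally show ?thesis .
  qed
  have "(\<integral>\<^sup>+ \<xi>. ennreal ((cmod (fourier_L1 f \<xi>))\<^sup>2) \<partial>lborel) =
      (\<integral>\<^sup>+ \<xi>. liminf (\<lambda>n. ennreal ((cmod (fourier_L1 f \<xi>))\<^sup>2 * gauss (\<delta> n *\<^sub>R \<xi>))) \<partial>lborel)"
  proof (rule nn_integral_cong)
    fix \<xi>
    have "(\<lambda>n. (cmod (fourier_L1 f \<xi>))\<^sup>2 * exp (- pi * (norm (\<delta> n *\<^sub>R \<xi>))\<^sup>2)) \<longlonglongrightarrow>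
        (cmod (fourier_L1 f \<xi>))\<^sup>2 * exp (- pi * (norm (0 *\<^sub>R \<xi>))\<^sup>2)"
      by (intro tendsto_intros d0)
    then have "(\<lambda>n. ennreal ((cmod (fourier_L1 f \<xi>))\<^sup>2 * gauss (\<delta> n *\<^sub>R \<xi>))) \<longlonglongrightarrow> ennreal ((cmod (fourier_L1 f \<xi>))\<^sup>2)"
      by (intro tendsto_ennrealI) (simp add: gauss_def)
    from lim_imp_Liminf[OF _ this] show "ennreal ((cmod (fourier_L1 f \<xi>))\<^sup>2) =
      liminf (\<lambda>n. ennreal ((cmod (fourier_L1 f \<xi>))\<^sup>2 * gauss (\<delta> n *\<^sub>R \<xi>)))"
      by simp
  qed
  also have "\<dots> \<le> liminf (\<lambda>n. \<integral>\<^sup>+ \<xi>. ennreal ((cmod (fourier_L1 f \<xi>))\<^sup>2 * gauss (\<delta> n *\<^sub>R \<xi>)) \<partial>lborel)"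
    by (rule nn_integral_liminf) measurable
  also have "\<dots> \<le> ?I"
    by (rule Liminf_le) (auto simp: le)
  finally show ?thesis .
qed simp

text \<open>
  For bounded continuous functions both sides of the regularised identity converge as \<open>\<delta>\<close> tends to 0
  by dominated convergence: continuity makes the Gaussian averages around each point converge to the
  value there, and boundedness dominates them.
\<close>

lemma Plancherel_bounded_continuous:
  fixes h :: "'a::euclidean_space \<Rightarrow> complex"
  assumes cont: "continuous_on UNIV h" and bnd: "\<And>s. cmod (h s) \<le> B"
    and int: "integrable lborel h" and sq: "integrable lborel (\<lambda>s. (cmod (h s))\<^sup>2)"
  shows "(LINT \<xi>|lborel. (cmod (fourier_L1 h \<xi>))\<^sup>2) = (LINT s|lborel. (cmod (h s))\<^sup>2)"
proof -
  have h[measurable]: "h \<in> borel_measurable borel" by (rule borel_measurable_continuous_onI[OF cont])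
  note [measurable] = borel_measurable_fourier_L1_borel[OF h]
  have B: "0 \<le> B" using bnd[of 0] norm_ge_zero order_trans by blast
  define \<delta> where "\<delta> n = 1 / real (Suc n)" for n
  have d: "0 < \<delta> n" for n by (simp add: \<delta>_def)
  have d0: "\<delta> \<longlonglongrightarrow> 0" unfolding \<delta>_def by (rule lim_1_over_n[THEN LIMSEQ_Suc])
  have i: "integrable lborel (\<lambda>\<xi>. (cmod (fourier_L1 h \<xi>))\<^sup>2)"
  proof -
    have "(\<integral>\<^sup>+ s. ennreal ((cmod (h s))\<^sup>2) \<partial>lborel) < \<infinity>" using sq by (simp add: integrable_iff_bounded)
    then have "(\<integral>\<^sup>+ \<xi>. ennreal ((cmod (fourier_L1 h \<xi>))\<^sup>2) \<partial>lborel) < \<infinity>"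
      using fourier_L1_contraction_borel[OF h int] by (rule le_less_trans[rotated])
    then show ?thesis by (simp add: integrable_iff_bounded)
  qed
  have "(\<lambda>n. LINT \<xi>|lborel. complex_of_real ((cmod (fourier_L1 h \<xi>))\<^sup>2 * gauss (\<delta> n *\<^sub>R \<xi>)))
      \<longlonglongrightarrow> (LINT \<xi>|lborel. complex_of_real ((cmod (fourier_L1 h \<xi>))\<^sup>2))"
  proof (rule integral_dominated_convergence[OF _ _ i])
    show "AE \<xi> in lborel. (\<lambda>n. complex_of_real ((cmod (fourier_L1 h \<xi>))\<^sup>2 * gauss (\<delta> n *\<^sub>R \<xi>)))
        \<longlonglongrightarrow> complex_of_real ((cmod (fourier_L1 h \<xi>))\<^sup>2)"
    proof (rule AE_I2)
      fix \<xi>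
      have "(\<lambda>n. complex_of_real ((cmod (fourier_L1 h \<xi>))\<^sup>2 * exp (- pi * (norm (\<delta> n *\<^sub>R \<xi>))\<^sup>2)))
        \<longlonglongrightarrow> complex_of_real ((cmod (fourier_L1 h \<xi>))\<^sup>2 * exp (- pi * (norm (0 *\<^sub>R \<xi>))\<^sup>2))"
        by (intro tendsto_intros d0)
      then show "(\<lambda>n. complex_of_real ((cmod (fourier_L1 h \<xi>))\<^sup>2 * gauss (\<delta> n *\<^sub>R \<xi>)))
        \<longlonglongrightarrow> complex_of_real ((cmod (fourier_L1 h \<xi>))\<^sup>2)"
        by (simp add: gauss_def)
    qed
    show "AE \<xi> in lborel. norm (complex_of_real ((cmod (fourier_L1 h \<xi>))\<^sup>2 * gauss (\<delta> n *\<^sub>R \<xi>))) \<le> (cmod (fourier_L1 h \<xi>))\<^sup>2" for n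
      unfolding norm_of_real
      by (simp add: abs_mult gauss_pos less_imp_le mult_left_le gauss_le_1)
  qed measurable
  then have 1: "(\<lambda>n. LINT s|lborel. h s * (LINT z|lborel. cnj (h (s + \<delta> n *\<^sub>R z)) * gauss z))
      \<longlonglongrightarrow> (LINT \<xi>|lborel. complex_of_real ((cmod (fourier_L1 h \<xi>))\<^sup>2))"
    unfolding gauss_regularized_energy[OF h int d] .
  have Bg: "integrable lborel (\<lambda>z::'a. B * gauss z)" by (rule integrable_mult_right[OF gauss_integrable])
  have dom: "cmod (cnj (h (s + \<delta> n *\<^sub>R z)) * gauss z) \<le> B * gauss z" for n s z
    by (simp add: norm_mult gauss_pos less_imp_le mult_right_mono bnd)
  have "(\<lambda>n. LINT s|lborel. h s * (LINT z|lborel. cnj (h (s + \<delta> n *\<^sub>R z)) * gauss z))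
      \<longlonglongrightarrow> (LINT s|lborel. h s * cnj (h s))"
  proof (rule integral_dominated_convergence[where w="\<lambda>s. cmod (h s) * B"])
    show "integrable lborel (\<lambda>s. cmod (h s) * B)" using int by simp
    show "AE s in lborel. (\<lambda>n. h s * (LINT z|lborel. cnj (h (s + \<delta> n *\<^sub>R z)) * gauss z)) \<longlonglongrightarrow> h s * cnj (h s)"
    proof (intro AE_I2 tendsto_mult tendsto_const)
      fix s
      have "(\<lambda>n. LINT z|lborel. cnj (h (s + \<delta> n *\<^sub>R z)) * gauss z) \<longlonglongrightarrow> (LINT z|lborel. cnj (h s) * gauss (z::'a))"
      proof (rule integral_dominated_convergence[OF _ _ Bg])
        show "AE z in lborel. (\<lambda>n. cnj (h (s + \<delta> n *\<^sub>R z)) * complex_of_real (gauss z)) \<longlonglongrightarrow> cnj (h s) * complex_of_real (gauss z)"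
        proof (intro AE_I2 tendsto_mult tendsto_const tendsto_cnj)
          fix z
          have "(\<lambda>n. s + \<delta> n *\<^sub>R z) \<longlonglongrightarrow> s + 0 *\<^sub>R z" by (intro tendsto_intros d0)
          then show "(\<lambda>n. h (s + \<delta> n *\<^sub>R z)) \<longlonglongrightarrow> h s"
            by (intro continuous_on_tendsto_compose[OF cont]) auto
        qed
      qed (use dom in auto)
      then show "(\<lambda>n. LINT z|lborel. cnj (h (s + \<delta> n *\<^sub>R z)) * gauss z) \<longlonglongrightarrow> cnj (h s)"
        by (simp add: gauss_integral)
    qed
    show "AE s in lborel. norm (h s * (LINT z|lborel. cnj (h (s + \<delta> n *\<^sub>R z)) * gauss z)) \<le> cmod (h s) * B" for n
    proof (rule AE_I2)
      fix s
      have "cmod (LINT z|lborel. cnj (h (s + \<delta> n *\<^sub>R z)) * gauss z) \<le> (LINT z|lborel. B * gauss (z::'a))"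
        by (rule Bochner_Integration.integral_norm_bound_integral[OF _ Bg dom])
           (rule Bochner_Integration.integrable_bound[OF Bg], use dom B in \<open>auto simp: gauss_pos less_imp_le\<close>)
      also have "\<dots> = B" by (simp add: gauss_integral)
      finally show "norm (h s * (LINT z|lborel. cnj (h (s + \<delta> n *\<^sub>R z)) * gauss z)) \<le> cmod (h s) * B"
        by (simp add: norm_mult mult_left_mono)
    qed
  qed measurable
  from LIMSEQ_unique[OF this 1]
  have "complex_of_real (LINT \<xi>|lborel. (cmod (fourier_L1 h \<xi>))\<^sup>2) = complex_of_real (LINT s|lborel. (cmod (h s))\<^sup>2)"
    unfolding integral_complex_of_real complex_norm_square[symmetric] by simp
  then show ?thesis by (simp only: of_real_eq_iff)
qed

lemma bounded_support_integrable:
  fixes f :: "'a::euclidean_space \<Rightarrow> complex"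
  assumes [measurable]: "f \<in> borel_measurable lebesgue" and B: "\<And>s. cmod (f s) \<le> B"
    and R: "\<And>s. R < norm s \<Longrightarrow> f s = 0"
  shows "integrable lebesgue f" "f \<in> L2"
proof -
  have i: "integrable lebesgue (\<lambda>s::'a. c * indicat_real (cball 0 R) s)" for c
    using emeasure_lborel_cball_finite[of "0::'a" R]
    by (intro integrable_mult_right integrable_real_indicator) auto
  show "integrable lebesgue f"
    by (rule Bochner_Integration.integrable_bound[OF i[of B]])
       (use B R in \<open>auto intro!: AE_I2 simp: indicator_def not_le intro: order_trans[OF B]\<close>)
  have "(cmod (f s))\<^sup>2 \<le> B\<^sup>2" for s using B by (intro power_mono) auto
  then have "integrable lebesgue (\<lambda>s. (cmod (f s))\<^sup>2)"
    by (intro Bochner_Integration.integrable_bound[OF i[of "B\<^sup>2"]])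
       (use R in \<open>auto intro!: AE_I2 simp: indicator_def not_le\<close>)
  then show "f \<in> L2" by (simp add: L2_space_def)
qed

text \<open>
  Cutting off both the argument and the value gives bounded functions of bounded support, which lie in
  \<open>L\<^sup>1\<close> and \<open>L\<^sup>2\<close> at once.
\<close>

definition trunc :: "nat \<Rightarrow> ('a::euclidean_space \<Rightarrow> complex) \<Rightarrow> 'a \<Rightarrow> complex" where
  "trunc n u s = (if norm s \<le> n \<and> cmod (u s) \<le> n then u s else 0)"

lemma trunc_bound: "cmod (trunc n u s) \<le> n" "n < norm s \<Longrightarrow> trunc n u s = 0" "cmod (trunc n u s) \<le> cmod (u s)"
  by (auto simp: trunc_def)

lemma trunc_measurable:
  assumes [measurable]: "u \<in> borel_measurable lebesgue"
  shows "trunc n u \<in> borel_measurable lebesgue"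
proof -
  have [measurable]: "(norm :: 'a::euclidean_space \<Rightarrow> real) \<in> borel_measurable lebesgue"
    by (rule measurable_completion) measurable
  show ?thesis unfolding trunc_def[abs_def] by measurable
qed

lemma trunc_integrable:
  assumes "u \<in> borel_measurable lebesgue"
  shows "integrable lebesgue (trunc n u)" "trunc n u \<in> L2"
  by (rule bounded_support_integrable[OF trunc_measurable[OF assms], of n n n]; simp add: trunc_bound)+

lemma L2_tendsto_dominated:
  fixes f :: "'a::euclidean_space \<Rightarrow> complex"
  assumes u: "\<And>n. u n \<in> borel_measurable lebesgue" and f: "f \<in> L2" and w: "w \<in> L2"
    and lim: "AE s in lebesgue. (\<lambda>n. u n s) \<longlonglongrightarrow> f s"
    and dom: "\<And>n. AE s in lebesgue. cmod (u n s) \<le> cmod (w s)"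
  shows "\<And>n. u n \<in> L2" "L2_tendsto u f"
proof -
  show uL: "u n \<in> L2" for n
    by (rule L2_bound(1)[OF w u, where c=1]) (use dom in auto)
  note [measurable] = u L2_measurable[OF f]
  have "(\<lambda>n. LINT s|lebesgue. (cmod (u n s - f s))\<^sup>2) \<longlonglongrightarrow> (LINT (s::'a)|lebesgue. 0)"
  proof (rule integral_dominated_convergence)
    show "integrable lebesgue (\<lambda>s. 2 * (cmod (w s))\<^sup>2 + 2 * (cmod (f s))\<^sup>2)"
      using L2_integrable_sq[OF w] L2_integrable_sq[OF f] by simp
    show "AE s in lebesgue. (\<lambda>n. (cmod (u n s - f s))\<^sup>2) \<longlonglongrightarrow> 0"
      using lim
    proof eventually_elim
      case (elim s)
      have "(\<lambda>n. (cmod (u n s - f s))\<^sup>2) \<longlonglongrightarrow> (cmod (f s - f s))\<^sup>2" by (intro tendsto_intros elim)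
      then show ?case by simp
    qed
    show "AE s in lebesgue. norm ((cmod (u n s - f s))\<^sup>2) \<le> 2 * (cmod (w s))\<^sup>2 + 2 * (cmod (f s))\<^sup>2" for n
      using dom[of n]
    proof eventually_elim
      case (elim s)
      have "(cmod (u n s))\<^sup>2 \<le> (cmod (w s))\<^sup>2" using elim by (intro power_mono) auto
      moreover have "(cmod (u n s - f s))\<^sup>2 \<le> 2 * (cmod (u n s))\<^sup>2 + 2 * (cmod (f s))\<^sup>2"
        using cmod_add_sq_le[of "u n s" "- f s"] by simp
      ultimately have "(cmod (u n s - f s))\<^sup>2 \<le> 2 * (cmod (w s))\<^sup>2 + 2 * (cmod (f s))\<^sup>2"
        by linarith
      then show ?case by simp
    qed
  qed measurable
  then show "L2_tendsto u f"
    by (simp add: L2_tendsto_iff[OF uL f] sq_norm_def)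
qed

lemma L2_tendsto_trunc:
  assumes "u \<in> L2"
  shows "L2_tendsto (\<lambda>n. trunc n u) u"
proof (rule L2_tendsto_dominated(2)[OF trunc_measurable[OF L2_measurable[OF assms]] assms assms])
  show "AE s in lebesgue. (\<lambda>n. trunc n u s) \<longlonglongrightarrow> u s"
  proof (intro AE_I2 tendsto_eventually)
    fix s
    obtain N :: nat where "max (norm s) (cmod (u s)) \<le> N" using real_arch_simple by blast
    then show "\<forall>\<^sub>F n in sequentially. trunc n u s = u s"
      by (intro eventually_sequentiallyI[of N]) (auto simp: trunc_def)
  qed
qed (simp add: trunc_bound)

text \<open>
  A measurable function is an almost everywhere limit of continuous ones. Clamping their values to
  the disc of radius \<open>B\<close> and multiplying by a continuous cutoff makes the convergence dominated, hence
  valid in \<open>L\<^sup>2\<close>.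
\<close>

lemma L2_dense_bounded_continuous:
  fixes u :: "'a::euclidean_space \<Rightarrow> complex"
  assumes u: "u \<in> borel_measurable lebesgue" and B: "\<And>s. cmod (u s) \<le> B" "0 < B"
    and R: "\<And>s. R < norm s \<Longrightarrow> u s = 0"
  obtains h where "\<And>n. continuous_on UNIV (h n)" "\<And>n s. cmod (h n s) \<le> B"
    "\<And>n. integrable lborel (h n)" "\<And>n. h n \<in> L2" "L2_tendsto h u"
proof -
  have "u measurable_on UNIV" by (rule lebesgue_measurable_imp_measurable_on[OF u]) simp
  then obtain N g where N: "negligible N" and g: "\<And>n. continuous_on UNIV (g n)"
    and lim: "\<And>x. x \<notin> N \<Longrightarrow> (\<lambda>n. g n x) \<longlonglongrightarrow> u x"
    unfolding measurable_on_def by auto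
  have aeN: "AE s in lebesgue. s \<notin> N"
    using N by (intro AE_not_in) (simp add: negligible_iff_null_sets)
  \<comment> \<open>\<open>c\<close> is the radial retraction onto the disc of radius \<open>B\<close>; \<open>\<kappa>\<close> is 1 on the ball of radius \<open>R\<close> and 0 off that of radius \<open>R + 1\<close>.\<close>
  define c where "c z = z * complex_of_real (B / max B (cmod z))" for z
  define \<kappa> where "\<kappa> s = max 0 (min 1 (R + 1 - norm s))" for s :: 'a
  define h where "h n s = complex_of_real (\<kappa> s) * c (g n s)" for n s
  have c_cont: "continuous_on UNIV c"
    unfolding c_def using B(2) by (intro continuous_intros) auto
  have c_le: "cmod (c z) \<le> B" for z
    using B(2) by (auto simp: c_def norm_mult norm_divide max_def field_simps)
  have c_id: "cmod z \<le> B \<Longrightarrow> c z = z" for z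
    using B(2) by (simp add: c_def max_def)
  have chi: "0 \<le> \<kappa> s" "\<kappa> s \<le> 1" "norm s \<le> R \<Longrightarrow> \<kappa> s = 1" "R + 1 < norm s \<Longrightarrow> \<kappa> s = 0" for s
    by (auto simp: \<kappa>_def)
  have cont: "continuous_on UNIV (h n)" for n
    unfolding h_def \<kappa>_def
    by (intro continuous_intros continuous_on_compose2[OF c_cont g]) auto
  have hB: "cmod (h n s) \<le> B" for n s
  proof -
    have "\<kappa> s * cmod (c (g n s)) \<le> 1 * B" using chi c_le B(2) by (intro mult_mono) auto
    then show ?thesis by (simp add: h_def norm_mult chi)
  qed
  have hR: "R + 1 < norm s \<Longrightarrow> h n s = 0" for n s by (simp add: h_def chi)
  have hm: "h n \<in> borel_measurable borel" for n by (rule borel_measurable_continuous_onI[OF cont])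
  then have hml: "h n \<in> borel_measurable lebesgue" for n by (intro measurable_completion) simp
  have hi: "integrable lebesgue (h n)" "h n \<in> L2" for n
    by (rule bounded_support_integrable[OF hml hB], erule hR)+
  define w where "w s = (if norm s \<le> R + 1 then complex_of_real B else 0)" for s :: 'a
  have "w \<in> borel_measurable borel" unfolding w_def by measurable
  then have "w \<in> borel_measurable lebesgue" by (intro measurable_completion) simp
  then have wL: "w \<in> L2"
    by (rule bounded_support_integrable(2)[of _ B "R+1"]) (use B in \<open>auto simp: w_def\<close>)
  have "L2_tendsto h u"
  proof (rule L2_tendsto_dominated(2)[OF hml bounded_support_integrable(2)[OF u B(1) R] wL])
    show "AE s in lebesgue. (\<lambda>n. h n s) \<longlonglongrightarrow> u s"
      using aeN
    proof eventually_elim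
      case (elim s)
      have "(\<lambda>n. c (g n s)) \<longlonglongrightarrow> c (u s)"
        by (rule continuous_on_tendsto_compose[OF c_cont lim[OF elim]]) auto
      then have "(\<lambda>n. h n s) \<longlonglongrightarrow> complex_of_real (\<kappa> s) * u s"
        unfolding h_def c_id[OF B(1)] by (intro tendsto_intros)
      moreover have "complex_of_real (\<kappa> s) * u s = u s"
        using chi(3)[of s] R[of s] by (cases "norm s \<le> R") auto
      ultimately show ?case by simp
    qed
    show "AE s in lebesgue. cmod (h n s) \<le> cmod (w s)" for n
      using hB hR B(2) by (auto simp: w_def not_le)
  qed
  moreover have "integrable lborel (h n)" for n
    using hi(1)[of n] hm by (simp add: integrable_completion)
  ultimately show thesis using that[of h] cont hB hi(2) by blast
qed

lemma fourier_L1_contraction: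
  fixes u :: "'a::euclidean_space \<Rightarrow> complex"
  assumes u: "u \<in> L2" "integrable lebesgue u"
  shows "fourier_L1 u \<in> L2" "sq_norm (fourier_L1 u) \<le> sq_norm u"
proof -
  obtain g where g: "g \<in> borel_measurable borel" "AE s in lebesgue. u s = g s"
    and gi: "integrable lborel g" and eq: "fourier_L1 u = fourier_L1 g"
    by (rule borel_representative_integral[OF u(2)])
  have gl: "g \<in> borel_measurable lebesgue" using g(1) by (intro measurable_completion) simp
  have gL: "g \<in> L2"
    by (rule L2_AE_cong[OF u(1) gl]) (use g(2) in auto)
  have m: "fourier_L1 g \<in> borel_measurable lebesgue"
    using borel_measurable_fourier_L1_borel[OF g(1)] by (intro measurable_completion) simp
  have le: "(\<integral>\<^sup>+ \<xi>. ennreal ((cmod (fourier_L1 g \<xi>))\<^sup>2) \<partial>lebesgue) \<le> ennreal (sq_norm g)"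
    unfolding nn_integral_sq_norm[OF gL, symmetric] nn_integral_completion
    by (rule fourier_L1_contraction_borel[OF g(1) gi])
  then have FL: "fourier_L1 g \<in> L2"
    unfolding L2_iff using m by (auto intro: le_less_trans)
  then show "fourier_L1 u \<in> L2" unfolding eq .
  have "sq_norm (fourier_L1 g) \<le> sq_norm g" by (rule sq_norm_le_nn[OF FL le sq_norm_nonneg])
  also have "sq_norm g = sq_norm u" by (rule sq_norm_AE_cong[OF L2_measurable[OF u(1)] gl]) (use g(2) in auto)
  finally show "sq_norm (fourier_L1 u) \<le> sq_norm u" unfolding eq .
qed

lemma fourier_L1_L2_tendsto:
  assumes u: "\<And>n. u n \<in> L2" "\<And>n. integrable lebesgue (u n)" and f: "f \<in> L2" "integrable lebesgue f"
    and uf: "L2_tendsto u f"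
  shows "L2_tendsto (\<lambda>n. fourier_L1 (u n)) (fourier_L1 f)"
proof -
  have FL: "fourier_L1 (u n) \<in> L2" for n by (rule fourier_L1_contraction(1)[OF u])
  have le: "sq_norm (\<lambda>\<xi>. fourier_L1 (u n) \<xi> - fourier_L1 f \<xi>) \<le> sq_norm (\<lambda>s. u n s - f s)" for n
    unfolding fourier_L1_diff[OF u(2) f(2), symmetric]
    by (rule fourier_L1_contraction(2)[OF L2_diff[OF u(1) f(1)]]) (intro Bochner_Integration.integrable_diff u f)
  have lim: "(\<lambda>n. sq_norm (\<lambda>s. u n s - f s)) \<longlonglongrightarrow> 0"
    using uf L2_tendsto_iff[of u f, OF u(1) f(1)] by blast
  have "(\<lambda>n. sq_norm (\<lambda>\<xi>. fourier_L1 (u n) \<xi> - fourier_L1 f \<xi>)) \<longlonglongrightarrow> 0"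
    by (rule tendsto_sandwich[OF _ _ tendsto_const lim]) (simp_all add: sq_norm_nonneg le)
  then show ?thesis
    using L2_tendsto_iff[of "\<lambda>n. fourier_L1 (u n)", OF FL fourier_L1_contraction(1)[OF f]] by blast
qed

text \<open>
  Both sides are continuous for the \<open>L\<^sup>2\<close> distance, the left one by the contraction property, so the
  equality spreads from bounded continuous functions to truncations, and from these to \<open>u\<close>.
\<close>

theorem Plancherel_L1_L2:
  fixes u :: "'a::euclidean_space \<Rightarrow> complex"
  assumes u: "u \<in> L2" "integrable lebesgue u"
  shows "sq_norm (fourier_L1 u) = sq_norm u"
proof -
  have trunc_case: "sq_norm (fourier_L1 (trunc n u)) = sq_norm (trunc n u)" for n
  proof -
    note tr = trunc_integrable[OF L2_measurable[OF u(1)], of n]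
    have tB: "cmod (trunc n u s) \<le> real (Suc n)" for s
      by (rule order_trans[OF trunc_bound(1)]) simp
    have tR: "real n < norm s \<Longrightarrow> trunc n u s = 0" for s by (rule trunc_bound(2))
    obtain h where h: "\<And>k. continuous_on UNIV (h k)" "\<And>k s. cmod (h k s) \<le> real (Suc n)"
      "\<And>k. integrable lborel (h k)" "\<And>k. h k \<in> L2" "L2_tendsto h (trunc n u)"
      by (rule L2_dense_bounded_continuous[OF trunc_measurable[OF L2_measurable[OF u(1)], of n] tB _ tR]) auto
    have hb: "h k \<in> borel_measurable borel" for k by (rule borel_measurable_continuous_onI[OF h(1)])
    have hi: "integrable lebesgue (h k)" for k using h(3)[of k] hb[of k] by (simp add: integrable_completion)
    have hF: "fourier_L1 (h k) \<in> L2" for k by (rule fourier_L1_contraction(1)[OF h(4) hi])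
    have lb: "sq_norm f = (LINT s|lborel. (cmod (f s))\<^sup>2)" if [measurable]: "f \<in> borel_measurable borel" for f :: "'a \<Rightarrow> complex"
      unfolding sq_norm_def by (rule integral_completion) measurable
    have eq: "sq_norm (fourier_L1 (h k)) = sq_norm (h k)" for k
      unfolding lb[OF hb] lb[OF borel_measurable_fourier_L1_borel[OF hb]]
    proof (rule Plancherel_bounded_continuous[OF h(1,2,3)])
      have [measurable]: "h k \<in> borel_measurable borel" by (rule hb)
      have "(\<lambda>s. (cmod (h k s))\<^sup>2) \<in> borel_measurable lborel" by measurable
      then show "integrable lborel (\<lambda>s. (cmod (h k s))\<^sup>2)"
        using L2_integrable_sq[OF h(4)[of k]] by (simp add: integrable_completion)
    qed
    have "(\<lambda>k. sq_norm (fourier_L1 (h k))) \<longlonglongrightarrow> sq_norm (fourier_L1 (trunc n u))"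
      by (rule L2_tendsto_sq_norm[OF hF fourier_L1_contraction(1)[OF tr(2,1)] fourier_L1_L2_tendsto[OF h(4) hi tr(2,1) h(5)]])
    then have "(\<lambda>k. sq_norm (h k)) \<longlonglongrightarrow> sq_norm (fourier_L1 (trunc n u))"
      unfolding eq .
    then show ?thesis by (rule LIMSEQ_unique[OF _ L2_tendsto_sq_norm[OF h(4) tr(2) h(5)]])
  qed
  note tr = trunc_integrable[OF L2_measurable[OF u(1)]]
  have "(\<lambda>n. sq_norm (fourier_L1 (trunc n u))) \<longlonglongrightarrow> sq_norm (fourier_L1 u)"
    by (rule L2_tendsto_sq_norm[OF fourier_L1_contraction(1)[OF tr(2,1)] fourier_L1_contraction(1)[OF u]
          fourier_L1_L2_tendsto[OF tr(2,1) u L2_tendsto_trunc[OF u(1)]]])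
  then have "(\<lambda>n. sq_norm (trunc n u)) \<longlonglongrightarrow> sq_norm (fourier_L1 u)"
    unfolding trunc_case .
  then show ?thesis
    by (rule LIMSEQ_unique[OF _ L2_tendsto_sq_norm[OF tr(2) u(1) L2_tendsto_trunc[OF u(1)]]])
qed

section \<open>The Fourier transform on square-integrable functions\<close>

lemma fourier_L1_isometry_diff:
  assumes "u \<in> L2" "integrable lebesgue u" "v \<in> L2" "integrable lebesgue v"
  shows "sq_norm (\<lambda>\<xi>. fourier_L1 u \<xi> - fourier_L1 v \<xi>) = sq_norm (\<lambda>s. u s - v s)"
  unfolding fourier_L1_diff[OF assms(2,4), symmetric]
  by (rule Plancherel_L1_L2[OF L2_diff[OF assms(1,3)] Bochner_Integration.integrable_diff[OF assms(2,4)]])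

text \<open>
  The definition quantifies over all approximating sequences; by Plancherel's theorem one is enough,
  because the transforms of two sequences with the same limit have vanishing distance.
\<close>

lemma is_fourier_L2I:
  assumes f: "f \<in> L2" and g: "g \<in> L2"
    and u: "\<And>n. u n \<in> L2" "\<And>n. integrable lebesgue (u n)" "L2_tendsto u f"
    and Fu: "L2_tendsto (\<lambda>n. fourier_L1 (u n)) g"
  shows "is_fourier_L2 f g"
  unfolding is_fourier_L2_def
proof (intro conjI allI impI g)
  fix v assume v: "(\<forall>n. v n \<in> L2 \<and> integrable lebesgue (v n)) \<and> L2_tendsto v f"
  then have vL: "\<And>n. v n \<in> L2" and vi: "\<And>n. integrable lebesgue (v n)" by auto
  have FuL: "fourier_L1 (u n) \<in> L2" and FvL: "fourier_L1 (v n) \<in> L2" for n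
    using fourier_L1_contraction(1) u vL vi by blast+
  have tu: "(\<lambda>n. sq_norm (\<lambda>s. u n s - f s)) \<longlonglongrightarrow> 0" using L2_tendsto_iff[of u f, OF u(1) f] u(3) by blast
  have tv: "(\<lambda>n. sq_norm (\<lambda>s. v n s - f s)) \<longlonglongrightarrow> 0" using L2_tendsto_iff[of v f, OF vL f] v by blast
  have tF: "(\<lambda>n. sq_norm (\<lambda>s. fourier_L1 (u n) s - g s)) \<longlonglongrightarrow> 0"
    using L2_tendsto_iff[of "\<lambda>n. fourier_L1 (u n)" g, OF FuL g] Fu by blast
  have le: "sq_norm (\<lambda>s. fourier_L1 (v n) s - g s) \<le>
      2 * (2 * sq_norm (\<lambda>s. v n s - f s) + 2 * sq_norm (\<lambda>s. u n s - f s)) + 2 * sq_norm (\<lambda>s. fourier_L1 (u n) s - g s)" for n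
  proof -
    have "sq_norm (\<lambda>s. fourier_L1 (v n) s - fourier_L1 (u n) s) \<le> 2 * sq_norm (\<lambda>s. v n s - f s) + 2 * sq_norm (\<lambda>s. u n s - f s)"
      using sq_norm_diff_le[OF vL[of n] f u(1)[of n]]
      unfolding fourier_L1_isometry_diff[OF vL vi u(1,2)] sq_norm_minus_commute[of f "u n"] .
    then show ?thesis using sq_norm_diff_le[OF FvL[of n] FuL[of n] g] by simp
  qed
  have lim: "(\<lambda>n. 2 * (2 * sq_norm (\<lambda>s. v n s - f s) + 2 * sq_norm (\<lambda>s. u n s - f s)) + 2 * sq_norm (\<lambda>s. fourier_L1 (u n) s - g s))
      \<longlonglongrightarrow> 0"
    using tendsto_add[OF tendsto_mult[OF tendsto_const[of 2] tendsto_add[OF tendsto_mult[OF tendsto_const[of 2] tv]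
        tendsto_mult[OF tendsto_const[of 2] tu]]] tendsto_mult[OF tendsto_const[of 2] tF]] by simp
  have "(\<lambda>n. sq_norm (\<lambda>s. fourier_L1 (v n) s - g s)) \<longlonglongrightarrow> 0"
    by (rule tendsto_sandwich[OF always_eventually always_eventually tendsto_const lim])
       (rule allI, rule sq_norm_nonneg, rule allI, rule le)
  then show "L2_tendsto (\<lambda>n. fourier_L1 (v n)) g"
    using L2_tendsto_iff[of "\<lambda>n. fourier_L1 (v n)" g, OF FvL g] by blast
qed

lemma trunc_L2:
  assumes "f \<in> L2"
  shows "trunc n f \<in> L2" "integrable lebesgue (trunc n f)" "fourier_L1 (trunc n f) \<in> L2"
  using trunc_integrable[OF L2_measurable[OF assms]] fourier_L1_contraction(1) by blast+

lemma is_fourier_L2_exists: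
  assumes f: "f \<in> L2"
  shows "\<exists>g. is_fourier_L2 f g"
proof -
  note tr = trunc_L2[OF f]
  have lim: "(\<lambda>n. sq_norm (\<lambda>s. trunc n f s - f s)) \<longlonglongrightarrow> 0"
    using L2_tendsto_iff[of "\<lambda>n. trunc n f" f, OF tr(1) f] L2_tendsto_trunc[OF f] by blast
  have "\<exists>g\<in>L2. L2_tendsto (\<lambda>n. fourier_L1 (trunc n f)) g"
  proof (rule L2_complete[OF tr(3)])
    fix e :: real assume "0 < e"
    then obtain N where N: "\<And>n. n \<ge> N \<Longrightarrow> sq_norm (\<lambda>s. trunc n f s - f s) < e / 4"
      using LIMSEQ_D[OF lim, of "e/4"] by (auto simp: sq_norm_nonneg)
    have "sq_norm (\<lambda>s. fourier_L1 (trunc m f) s - fourier_L1 (trunc n f) s) \<le> e" if "m \<ge> N" "n \<ge> N" for m n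
      using sq_norm_diff_le[OF tr(1)[of m] f tr(1)[of n]] N[OF that(1)] N[OF that(2)]
        fourier_L1_isometry_diff[OF tr(1,2)[of m] tr(1,2)[of n]] sq_norm_minus_commute[of f "trunc n f"] by linarith
    then show "\<exists>N. \<forall>m\<ge>N. \<forall>n\<ge>N. sq_norm (\<lambda>s. fourier_L1 (trunc m f) s - fourier_L1 (trunc n f) s) \<le> e" by blast
  qed
  then show ?thesis
    using is_fourier_L2I[of f _ "\<lambda>n. trunc n f", OF f _ tr(1,2) L2_tendsto_trunc[OF f]] by blast
qed

lemma is_fourier_L2_fourier_L2: "f \<in> L2 \<Longrightarrow> is_fourier_L2 f (fourier_L2 f)"
  unfolding fourier_L2_def by (rule someI_ex[OF is_fourier_L2_exists])

lemma fourier_L2_in_L2: "f \<in> L2 \<Longrightarrow> fourier_L2 f \<in> L2"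
  using is_fourier_L2_fourier_L2 by (auto simp: is_fourier_L2_def)

lemma is_fourier_L2_trunc:
  "f \<in> L2 \<Longrightarrow> is_fourier_L2 f g \<Longrightarrow> L2_tendsto (\<lambda>n. fourier_L1 (trunc n f)) g"
  unfolding is_fourier_L2_def by (auto intro: trunc_L2 L2_tendsto_trunc)

lemmas fourier_L2_trunc = is_fourier_L2_trunc[OF _ is_fourier_L2_fourier_L2]

lemma fourier_L2_unique:
  assumes f: "f \<in> L2" and g: "is_fourier_L2 f g"
  shows "AE \<xi> in lebesgue. fourier_L2 f \<xi> = g \<xi>"
proof (rule L2_tendsto_unique[of "\<lambda>n. fourier_L1 (trunc n f)"])
  show "g \<in> L2" using g by (simp add: is_fourier_L2_def)
qed (intro trunc_L2 fourier_L2_in_L2 f fourier_L2_trunc is_fourier_L2_trunc g)+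

theorem Plancherel:
  assumes f: "f \<in> L2"
  shows "sq_norm (fourier_L2 f) = sq_norm f"
proof -
  have "(\<lambda>n. sq_norm (fourier_L1 (trunc n f))) \<longlonglongrightarrow> sq_norm (fourier_L2 f)"
    by (rule L2_tendsto_sq_norm[OF trunc_L2(3)[OF f] fourier_L2_in_L2[OF f] fourier_L2_trunc[OF f f]])
  then have "(\<lambda>n. sq_norm (trunc n f)) \<longlonglongrightarrow> sq_norm (fourier_L2 f)"
    unfolding Plancherel_L1_L2[OF trunc_L2(1,2)[OF f]] .
  then show ?thesis
    by (rule LIMSEQ_unique[OF _ L2_tendsto_sq_norm[OF trunc_L2(1)[OF f] f L2_tendsto_trunc[OF f]]])
qed

text \<open>
  The kernel \<open>cis (- 2 * pi * (x \<bullet> s))\<close> is symmetric in \<open>x\<close> and \<open>s\<close>.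
\<close>

lemma fourier_L1_multiplication:
  fixes u v :: "'a::euclidean_space \<Rightarrow> complex"
  assumes u: "integrable lebesgue u" and v: "integrable lebesgue v"
  shows "(LINT s|lebesgue. u s * fourier_L1 v s) = (LINT s|lebesgue. fourier_L1 u s * v s)"
proof -
  obtain f where f: "f \<in> borel_measurable borel" "integrable lborel f"
    "AE s in lebesgue. u s = f s" and Fu: "fourier_L1 u = fourier_L1 f"
    by (rule borel_representative_integral[OF u])
  obtain g where g: "g \<in> borel_measurable borel" "integrable lborel g"
    "AE s in lebesgue. v s = g s" and Fv: "fourier_L1 v = fourier_L1 g"
    by (rule borel_representative_integral[OF v])
  have fl: "f \<in> borel_measurable lebesgue" and gl: "g \<in> borel_measurable lebesgue"
    using f(1) g(1) by (auto intro: measurable_completion)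
  note [measurable] = f(1) g(1) borel_measurable_fourier_L1_borel[OF f(1)] borel_measurable_fourier_L1_borel[OF g(1)]
  have Fl: "fourier_L1 f \<in> borel_measurable lebesgue" "fourier_L1 g \<in> borel_measurable lebesgue"
    by (auto intro: measurable_completion)
  have "(LINT s|lebesgue. u s * fourier_L1 v s) = (LINT s|lebesgue. f s * fourier_L1 g s)"
    unfolding Fv using f(3) fl Fl u by (intro integral_cong_AE) auto
  also have "\<dots> = (LINT s|lborel. f s * fourier_L1 g s)"
    by (rule integral_completion) measurable
  also have "\<dots> = (LINT s|lborel. (LINT x|lborel. g x * cis (- 2 * pi * (x \<bullet> s))) * f s)"
    by (simp add: fourier_L1_lborel[OF g(1)] mult.commute)
  also have "\<dots> = (LINT x|lborel. g x * (LINT s|lborel. cis (- 2 * pi * (x \<bullet> s)) * f s))"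
    by (rule Fubini_bounded_kernel[OF g(2) f(2)])
       (auto simp: split_def intro!: borel_measurable_continuous_onI continuous_on_cis continuous_intros)
  also have "\<dots> = (LINT x|lborel. fourier_L1 f x * g x)"
    by (simp add: fourier_L1_lborel[OF f(1)] mult.commute inner_commute)
  also have "\<dots> = (LINT x|lebesgue. fourier_L1 f x * g x)"
    by (rule integral_completion[symmetric]) measurable
  also have "\<dots> = (LINT x|lebesgue. fourier_L1 u x * v x)"
    unfolding Fu using g(3) gl Fl v by (intro integral_cong_AE) auto
  finally show ?thesis .
qed

lemma fourier_L2_multiplication:
  assumes f: "f \<in> L2" and g: "g \<in> L2"
  shows "(LINT s|lebesgue. f s * fourier_L2 g s) = (LINT s|lebesgue. fourier_L2 f s * g s)"
proof -
  have "(\<lambda>n. LINT s|lebesgue. trunc n f s * fourier_L1 (trunc n g) s) \<longlonglongrightarrow> (LINT s|lebesgue. f s * fourier_L2 g s)"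
    by (rule L2_tendsto_integral_mult[OF trunc_L2(1)[OF f] f L2_tendsto_trunc[OF f]
          trunc_L2(3)[OF g] fourier_L2_in_L2[OF g] fourier_L2_trunc[OF g g]])
  then have *: "(\<lambda>n. LINT s|lebesgue. fourier_L1 (trunc n f) s * trunc n g s) \<longlonglongrightarrow> (LINT s|lebesgue. f s * fourier_L2 g s)"
    unfolding fourier_L1_multiplication[OF trunc_L2(2)[OF f] trunc_L2(2)[OF g]] .
  show ?thesis
    by (rule LIMSEQ_unique[OF *]) (rule L2_tendsto_integral_mult[OF trunc_L2(3)[OF f] fourier_L2_in_L2[OF f] fourier_L2_trunc[OF f f]
          trunc_L2(1)[OF g] g L2_tendsto_trunc[OF g]])
qed

text \<open>
  Conjugating the kernel of the Fourier integral inverts it. Expressing the inverse by the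
  transform itself makes isometry and the multiplication formula available for it at once.
\<close>

definition inv_fourier_L2 :: "('a::euclidean_space \<Rightarrow> complex) \<Rightarrow> 'a \<Rightarrow> complex" where
  "inv_fourier_L2 g s = cnj (fourier_L2 (\<lambda>\<xi>. cnj (g \<xi>)) s)"

lemma inv_fourier_L2_in_L2: "g \<in> L2 \<Longrightarrow> inv_fourier_L2 g \<in> L2"
  unfolding inv_fourier_L2_def[abs_def] by (intro L2_cnj fourier_L2_in_L2)

lemma sq_norm_diff_expand:
  assumes f: "f \<in> L2" and g: "g \<in> L2"
  shows "sq_norm (\<lambda>s. f s - g s) = sq_norm f - 2 * Re (LINT s|lebesgue. f s * cnj (g s)) + sq_norm g"
proof -
  note i = L2_mult_integrable[OF f L2_cnj[OF g]]
  have eq: "(cmod (f s - g s))\<^sup>2 = (cmod (f s))\<^sup>2 - 2 * Re (f s * cnj (g s)) + (cmod (g s))\<^sup>2" for s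
    unfolding cmod_power2 by (simp add: power2_eq_square algebra_simps)
  show ?thesis
    unfolding sq_norm_def eq
    using L2_integrable_sq[OF f] L2_integrable_sq[OF g] i integrable_Re[OF i]
    by (simp add: integral_Re del: times_complex.sel)
qed

text \<open>
  Write \<open>F\<close> for the transform and \<open>J\<close> for \<open>inv_fourier_L2\<close>. The multiplication formula says that \<open>J\<close> is
  the adjoint of \<open>F\<close>, so that \<open>\<langle>J F f, f\<rangle>\<close> is the squared norm of \<open>F f\<close>; since \<open>F\<close> and \<open>J\<close> are isometries,
  expanding the square shows that \<open>J F f - f\<close> has norm 0.
\<close>

theorem inv_fourier_fourier_L2:
  assumes f: "f \<in> L2"
  shows "AE s in lebesgue. inv_fourier_L2 (fourier_L2 f) s = f s"
proof -
  let ?F = "fourier_L2 f" and ?J = "inv_fourier_L2 (fourier_L2 f)"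
  have F: "?F \<in> L2" and Fc: "(\<lambda>s. cnj (?F s)) \<in> L2" and J: "?J \<in> L2"
    using f by (auto intro: L2_cnj fourier_L2_in_L2 inv_fourier_L2_in_L2)
  have "(LINT s|lebesgue. ?J s * cnj (f s)) = cnj (LINT s|lebesgue. f s * fourier_L2 (\<lambda>s. cnj (?F s)) s)"
    by (simp add: inv_fourier_L2_def mult.commute flip: Bochner_Integration.integral_cnj)
  also have "\<dots> = cnj (LINT s|lebesgue. ?F s * cnj (?F s))"
    by (simp add: fourier_L2_multiplication[OF f Fc])
  also have "\<dots> = sq_norm f"
    unfolding sq_norm_eq_integral_cnj[symmetric] by (simp add: Plancherel[OF f])
  finally have "Re (LINT s|lebesgue. ?J s * cnj (f s)) = sq_norm f" by simp
  moreover have "sq_norm ?J = sq_norm f"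
    unfolding inv_fourier_L2_def[abs_def] sq_norm_cnj by (simp add: Plancherel[OF Fc] sq_norm_cnj Plancherel[OF f])
  ultimately have "sq_norm (\<lambda>s. ?J s - f s) = 0"
    by (simp add: sq_norm_diff_expand[OF J f])
  then show ?thesis using sq_norm_eq_0_iff[OF L2_diff[OF J f]] by simp
qed

text \<open>
  Surjectivity of the transform. It is the previous theorem for the conjugate of \<open>g\<close>, conjugated.
\<close>

corollary fourier_inv_fourier_L2:
  assumes g: "g \<in> L2"
  shows "AE \<xi> in lebesgue. fourier_L2 (inv_fourier_L2 g) \<xi> = g \<xi>"
  using inv_fourier_fourier_L2[OF L2_cnj[OF g]]
  by (simp add: inv_fourier_L2_def[abs_def])

lemma Parseval:
  assumes f: "f \<in> L2" and g: "g \<in> L2"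
  shows "(LINT s|lebesgue. f s * g s) = (LINT \<xi>|lebesgue. fourier_L2 f \<xi> * inv_fourier_L2 g \<xi>)"
proof -
  note J = inv_fourier_L2_in_L2[OF g]
  have "(LINT s|lebesgue. f s * g s) = (LINT s|lebesgue. f s * fourier_L2 (inv_fourier_L2 g) s)"
    using fourier_inv_fourier_L2[OF g]
    by (intro integral_cong_AE borel_measurable_times L2_measurable f g fourier_L2_in_L2 J) auto
  then show ?thesis using fourier_L2_multiplication[OF f J] by simp
qed

section \<open>Transforms of products and convolutions\<close>

text \<open>
  Reflections preserve Lebesgue measure on its full \<open>\<sigma>\<close>-algebra, so that functions and null sets
  that are only Lebesgue measurable may be reflected as well.
\<close>

lemma
  fixes t :: "'a::euclidean_space"
  shows measurable_lebesgue_reflect: "(\<lambda>x. t - x) \<in> lebesgue \<rightarrow>\<^sub>M lebesgue"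
    and distr_lebesgue_reflect: "distr lebesgue lebesgue (\<lambda>x. t - x) = lebesgue"
proof -
  have T: "t + (\<Sum>j\<in>Basis. (-1 * (x \<bullet> j)) *\<^sub>R j) = t - x" for x :: 'a
    by (simp add: sum_negf euclidean_representation)
  show "(\<lambda>x. t - x) \<in> lebesgue \<rightarrow>\<^sub>M lebesgue"
    using lebesgue_affine_measurable[of "\<lambda>_. -1" t] unfolding T by simp
  show "distr lebesgue lebesgue (\<lambda>x. t - x) = lebesgue"
    using lebesgue_affine_euclidean[of "\<lambda>_. -1" t] unfolding T by (simp add: density_1)
qed

lemma AE_lebesgue_reflect:
  assumes "AE x in lebesgue. P x"
  shows "AE x in lebesgue. P (t - x)"
proof -
  have "AE x in distr lebesgue lebesgue (\<lambda>x. t - x). P x"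
    unfolding distr_lebesgue_reflect by (rule assms)
  then show ?thesis by (rule AE_distrD[OF measurable_lebesgue_reflect])
qed

lemma nn_integral_lebesgue_reflect:
  assumes "f \<in> borel_measurable lebesgue"
  shows "(\<integral>\<^sup>+ x. f (t - x) \<partial>lebesgue) = (\<integral>\<^sup>+ x. f x \<partial>lebesgue)"
  using nn_integral_distr[OF measurable_lebesgue_reflect[of t], of f] assms
  by (simp add: distr_lebesgue_reflect)

lemma L2_reflect:
  assumes f: "f \<in> L2"
  shows "(\<lambda>x. f (t - x)) \<in> L2"
proof -
  have m: "f \<in> borel_measurable lebesgue" by (rule L2_measurable[OF f])
  have "(\<lambda>x. f (t - x)) \<in> borel_measurable lebesgue"
    by (rule measurable_compose[OF measurable_lebesgue_reflect m])
  moreover have "(\<integral>\<^sup>+ x. ennreal ((cmod (f (t - x)))\<^sup>2) \<partial>lebesgue) = (\<integral>\<^sup>+ x. ennreal ((cmod (f x))\<^sup>2) \<partial>lebesgue)"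
    using m by (intro nn_integral_lebesgue_reflect) measurable
  ultimately show ?thesis using f by (simp add: L2_iff)
qed

lemma L2_tendsto_cnj_reflect:
  assumes u: "\<And>n. u n \<in> L2" and f: "f \<in> L2" and lim: "L2_tendsto u f"
  shows "L2_tendsto (\<lambda>n x. cnj (u n (t - x))) (\<lambda>x. cnj (f (t - x)))"
proof (rule L2_tendsto_cnj)
  have m: "(\<lambda>x. ennreal ((cmod (u n x - f x))\<^sup>2)) \<in> borel_measurable lebesgue" for n
    using L2_measurable[OF u[of n]] L2_measurable[OF f] by measurable
  have "(\<integral>\<^sup>+ x. ennreal ((cmod (u n (t - x) - f (t - x)))\<^sup>2) \<partial>lebesgue) =
      (\<integral>\<^sup>+ x. ennreal ((cmod (u n x - f x))\<^sup>2) \<partial>lebesgue)" for n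
    by (rule nn_integral_lebesgue_reflect[OF m])
  then show "L2_tendsto (\<lambda>n x. u n (t - x)) (\<lambda>x. f (t - x))"
    using lim by (simp add: L2_tendsto_def)
qed

lemma L2_mult_cis:
  fixes f :: "'a::euclidean_space \<Rightarrow> complex"
  assumes "f \<in> L2"
  shows "(\<lambda>s. f s * cis (c * (s \<bullet> \<xi>))) \<in> L2"
proof -
  have [measurable]: "f \<in> borel_measurable lebesgue" by (rule L2_measurable[OF assms])
  have [measurable]: "(\<lambda>s. cis (c * (s \<bullet> \<xi>))) \<in> borel_measurable lebesgue"
    by (rule measurable_completion) measurable
  show ?thesis by (rule L2_bound(1)[OF assms, where c=1]) (auto simp: norm_mult)
qed

lemma fourier_L2_cnj_modulated:
  fixes v :: "'a::euclidean_space \<Rightarrow> complex"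
  assumes v: "v \<in> L2"
  shows "AE \<eta> in lebesgue. fourier_L2 (\<lambda>s. cnj (v s) * cis (2 * pi * (s \<bullet> \<xi>))) \<eta> = cnj (fourier_L2 v (\<xi> - \<eta>))"
proof (rule fourier_L2_unique)
  show *: "(\<lambda>s. cnj (v s) * cis (2 * pi * (s \<bullet> \<xi>))) \<in> L2"
    by (rule L2_mult_cis[OF L2_cnj[OF v]])
  let ?u = "\<lambda>n s. cnj (trunc n v s) * cis (2 * pi * (s \<bullet> \<xi>))"
  have Fu: "fourier_L1 (?u n) = (\<lambda>\<eta>. cnj (fourier_L1 (trunc n v) (\<xi> - \<eta>)))" for n
  proof
    fix \<eta>
    have "?u n s * cis (- 2 * pi * (s \<bullet> \<eta>)) = cnj (trunc n v s * cis (- 2 * pi * (s \<bullet> (\<xi> - \<eta>))))" for s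
      by (simp add: cis_cnj cis_mult inner_diff_right algebra_simps)
    then show "fourier_L1 (?u n) \<eta> = cnj (fourier_L1 (trunc n v) (\<xi> - \<eta>))"
      unfolding fourier_L1_def by (simp only: Bochner_Integration.integral_cnj)
  qed
  have "L2_tendsto ?u (\<lambda>s. cnj (v s) * cis (2 * pi * (s \<bullet> \<xi>)))"
  proof -
    have "cmod (?u n s - cnj (v s) * cis (2 * pi * (s \<bullet> \<xi>))) = cmod (trunc n v s - v s)" for n s
      by (simp add: norm_mult flip: left_diff_distrib complex_cnj_diff)
    then show ?thesis using L2_tendsto_trunc[OF v] by (simp add: L2_tendsto_def)
  qed
  moreover have "L2_tendsto (\<lambda>n. fourier_L1 (?u n)) (\<lambda>\<eta>. cnj (fourier_L2 v (\<xi> - \<eta>)))"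
    unfolding Fu
    by (rule L2_tendsto_cnj_reflect[of "\<lambda>n. fourier_L1 (trunc n v)", OF trunc_L2(3)[OF v] fourier_L2_in_L2[OF v] fourier_L2_trunc[OF v v]])
  moreover have "?u n \<in> L2" "integrable lebesgue (?u n)" for n
    by (intro L2_mult_cis L2_cnj trunc_L2 v) (intro integrable_mult_cis Bochner_Integration.integrable_cnj trunc_L2 v)
  ultimately show "is_fourier_L2 (\<lambda>s. cnj (v s) * cis (2 * pi * (s \<bullet> \<xi>))) (\<lambda>\<eta>. cnj (fourier_L2 v (\<xi> - \<eta>)))"
    by (intro is_fourier_L2I[of _ _ ?u] * L2_cnj L2_reflect fourier_L2_in_L2 v)
qed

text \<open>
  Parseval's identity applied to \<open>u\<close> and to \<open>v\<close> times a character, whose transform is a translate. The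
  equality holds at every point \<open>\<xi>\<close>, as the product of two functions in \<open>L\<^sup>2\<close> is integrable.
\<close>

theorem fourier_L1_product:
  fixes u v :: "'a::euclidean_space \<Rightarrow> complex"
  assumes u: "u \<in> L2" and v: "v \<in> L2"
  shows "fourier_L1 (\<lambda>s. u s * v s) \<xi> = (LINT \<eta>|lebesgue. fourier_L2 u \<eta> * fourier_L2 v (\<xi> - \<eta>))"
proof -
  let ?g = "\<lambda>s. v s * cis (- 2 * pi * (s \<bullet> \<xi>))"
  have g: "?g \<in> L2" by (rule L2_mult_cis[OF v])
  have "(\<lambda>s. cnj (?g s)) = (\<lambda>s. cnj (v s) * cis (2 * pi * (s \<bullet> \<xi>)))"
    by (simp add: cis_cnj)
  then have ae: "AE \<eta> in lebesgue. inv_fourier_L2 ?g \<eta> = fourier_L2 v (\<xi> - \<eta>)"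
    using fourier_L2_cnj_modulated[OF v, of \<xi>] by (simp only: inv_fourier_L2_def) (auto elim: eventually_mono)
  have "fourier_L1 (\<lambda>s. u s * v s) \<xi> = (LINT s|lebesgue. u s * ?g s)"
    by (simp add: fourier_L1_def mult.assoc)
  also have "\<dots> = (LINT \<eta>|lebesgue. fourier_L2 u \<eta> * inv_fourier_L2 ?g \<eta>)"
    by (rule Parseval[OF u g])
  also have "\<dots> = (LINT \<eta>|lebesgue. fourier_L2 u \<eta> * fourier_L2 v (\<xi> - \<eta>))"
    using ae by (intro integral_cong_AE borel_measurable_times L2_measurable inv_fourier_L2_in_L2 L2_reflect fourier_L2_in_L2 u v g) auto
  finally show ?thesis .
qed

definition convolve :: "('a::euclidean_space \<Rightarrow> complex) \<Rightarrow> ('a \<Rightarrow> complex) \<Rightarrow> 'a \<Rightarrow> complex" where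
  "convolve h w t = (LINT s|lebesgue. h s * w (t - s))"

lemma convolution_kernel_measurable:
  fixes h w :: "'a::euclidean_space \<Rightarrow> complex"
  assumes [measurable]: "h \<in> borel_measurable borel" "w \<in> borel_measurable borel"
  shows "(\<lambda>(s, t). h s * w (t - s)) \<in> borel_measurable borel"
proof -
  have "(\<lambda>(s, t). h s * w (t - s)) \<in> borel_measurable (borel \<Otimes>\<^sub>M borel)" by measurable
  then show ?thesis by (simp add: borel_prod)
qed

lemma convolve_lebesgue_to_lborel:
  fixes h w h' w' :: "'a::euclidean_space \<Rightarrow> complex"
  assumes h: "h \<in> borel_measurable lebesgue" "h' \<in> borel_measurable borel" "AE s in lebesgue. h s = h' s"
    and w: "w \<in> borel_measurable lebesgue" "w' \<in> borel_measurable borel" "AE s in lebesgue. w s = w' s"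
  shows "convolve h w t = (LINT s|lborel. h' s * w' (t - s))"
    and "integrable lebesgue (\<lambda>s. h s * w (t - s)) \<longleftrightarrow> integrable lborel (\<lambda>s. h' s * w' (t - s))"
proof -
  note [measurable] = h(2) w(2)
  have m: "(\<lambda>s. h s * w (t - s)) \<in> borel_measurable lebesgue"
    by (rule borel_measurable_times[OF h(1) measurable_compose[OF measurable_lebesgue_reflect w(1)]])
  have mb: "(\<lambda>s. h' s * w' (t - s)) \<in> borel_measurable lborel" by measurable
  then have m': "(\<lambda>s. h' s * w' (t - s)) \<in> borel_measurable lebesgue" by (rule measurable_completion)
  have ae: "AE s in lebesgue. h s * w (t - s) = h' s * w' (t - s)"
    using h(3) AE_lebesgue_reflect[OF w(3), of t] by eventually_elim simp
  show "convolve h w t = (LINT s|lborel. h' s * w' (t - s))"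
    unfolding convolve_def integral_cong_AE[OF m m' ae] by (rule integral_completion[OF mb])
  show "integrable lebesgue (\<lambda>s. h s * w (t - s)) \<longleftrightarrow> integrable lborel (\<lambda>s. h' s * w' (t - s))"
    unfolding integrable_cong_AE[OF m m' ae] by (rule integrable_completion[OF mb])
qed

text \<open>
  The Cauchy--Schwarz inequality for the measure with density \<open>cmod \<circ> h\<close>, realised by splitting
  \<open>cmod (h s)\<close> into two square roots, followed by Tonelli's theorem.
\<close>

lemma Young_nn_integral:
  fixes h w :: "'a::euclidean_space \<Rightarrow> complex"
  assumes [measurable]: "h \<in> borel_measurable borel" "w \<in> borel_measurable borel"
  shows "(\<integral>\<^sup>+ t. (\<integral>\<^sup>+ s. ennreal (cmod (h s * w (t - s))) \<partial>lborel)\<^sup>2 \<partial>lborel)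
    \<le> (\<integral>\<^sup>+ s. ennreal (cmod (h s)) \<partial>lborel)\<^sup>2 * (\<integral>\<^sup>+ s. ennreal ((cmod (w s))\<^sup>2) \<partial>lborel)"
proof -
  let ?H = "\<integral>\<^sup>+ s. ennreal (cmod (h s)) \<partial>lborel" and ?W = "\<integral>\<^sup>+ s. ennreal ((cmod (w s))\<^sup>2) \<partial>lborel"
  have "(\<integral>\<^sup>+ s. ennreal (cmod (h s * w (t - s))) \<partial>lborel)\<^sup>2 \<le>
      ?H * (\<integral>\<^sup>+ s. ennreal (cmod (h s)) * ennreal ((cmod (w (t - s)))\<^sup>2) \<partial>lborel)" for t
  proof -
    let ?f = "\<lambda>s. ennreal (sqrt (cmod (h s)))" and ?g = "\<lambda>s. ennreal (sqrt (cmod (h s)) * cmod (w (t - s)))"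
    have "(\<integral>\<^sup>+ s. ?f s * ?g s \<partial>lborel)\<^sup>2 \<le> (\<integral>\<^sup>+ s. (?f s)\<^sup>2 \<partial>lborel) * (\<integral>\<^sup>+ s. (?g s)\<^sup>2 \<partial>lborel)"
      by (rule Cauchy_Schwarz_nn_integral) measurable
    moreover have "?f s * ?g s = ennreal (cmod (h s * w (t - s)))" for s
      by (simp add: norm_mult flip: ennreal_mult mult.assoc)
    moreover have "(?f s)\<^sup>2 = ennreal (cmod (h s))" for s
      by (simp add: ennreal_power)
    moreover have "(?g s)\<^sup>2 = ennreal (cmod (h s)) * ennreal ((cmod (w (t - s)))\<^sup>2)" for s
      by (simp add: ennreal_power power_mult_distrib flip: ennreal_mult)
    ultimately show ?thesis by simp
  qed
  then have "(\<integral>\<^sup>+ t. (\<integral>\<^sup>+ s. ennreal (cmod (h s * w (t - s))) \<partial>lborel)\<^sup>2 \<partial>lborel) \<le>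
      (\<integral>\<^sup>+ t. ?H * (\<integral>\<^sup>+ s. ennreal (cmod (h s)) * ennreal ((cmod (w (t - s)))\<^sup>2) \<partial>lborel) \<partial>lborel)"
    by (rule nn_integral_mono)
  also have "\<dots> = ?H * (\<integral>\<^sup>+ t. \<integral>\<^sup>+ s. ennreal (cmod (h s)) * ennreal ((cmod (w (t - s)))\<^sup>2) \<partial>lborel \<partial>lborel)"
    by (rule nn_integral_cmult) measurable
  also have "(\<integral>\<^sup>+ t. \<integral>\<^sup>+ s. ennreal (cmod (h s)) * ennreal ((cmod (w (t - s)))\<^sup>2) \<partial>lborel \<partial>lborel) =
      (\<integral>\<^sup>+ s. \<integral>\<^sup>+ t. ennreal (cmod (h s)) * ennreal ((cmod (w (t - s)))\<^sup>2) \<partial>lborel \<partial>lborel)"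
    by (rule lborel_pair.Fubini') measurable
  also have "\<dots> = (\<integral>\<^sup>+ s. ennreal (cmod (h s)) * ?W \<partial>lborel)"
  proof (rule nn_integral_cong)
    fix s
    have "(\<integral>\<^sup>+ t. ennreal ((cmod (w (t - s)))\<^sup>2) \<partial>lborel) = ?W"
      using lborel_nn_integral_shift[of "\<lambda>t. ennreal ((cmod (w t))\<^sup>2)" "- s"] by simp
    then show "(\<integral>\<^sup>+ t. ennreal (cmod (h s)) * ennreal ((cmod (w (t - s)))\<^sup>2) \<partial>lborel) = ennreal (cmod (h s)) * ?W"
      by (subst nn_integral_cmult) auto
  qed
  also have "\<dots> = ?H * ?W" by (rule nn_integral_multc) measurable
  finally show ?thesis by (simp add: power2_eq_square mult.assoc)
qed

theorem Young_convolve_L1_L2: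
  fixes h w :: "'a::euclidean_space \<Rightarrow> complex"
  assumes h: "integrable lebesgue h" and w: "w \<in> L2"
  shows "AE t in lebesgue. integrable lebesgue (\<lambda>s. h s * w (t - s))"
    and "convolve h w \<in> L2" "sq_norm (convolve h w) \<le> (LINT s|lebesgue. cmod (h s))\<^sup>2 * sq_norm w"
proof -
  have hm: "h \<in> borel_measurable lebesgue" using h by auto
  obtain h' where h': "h' \<in> borel_measurable borel" "integrable lborel h'" "AE s in lebesgue. h s = h' s"
    using borel_representative_integral[OF h] by blast
  obtain w' where w': "w' \<in> borel_measurable borel" "AE s in lebesgue. w s = w' s" "AE s in lborel. w s = w' s"
    using borel_representative[OF L2_measurable[OF w]] by blast
  note cv = convolve_lebesgue_to_lborel[OF hm h'(1,3) L2_measurable[OF w] w'(1,2)]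
  note [measurable] = h'(1) w'(1)
  let ?I = "\<lambda>t. \<integral>\<^sup>+ s. ennreal (cmod (h' s * w' (t - s))) \<partial>lborel"
  have H: "(\<integral>\<^sup>+ s. ennreal (cmod (h' s)) \<partial>lborel) = ennreal (LINT s|lebesgue. cmod (h s))"
  proof -
    have "(\<integral>\<^sup>+ s. ennreal (cmod (h' s)) \<partial>lborel) = (\<integral>\<^sup>+ s. ennreal (cmod (h' s)) \<partial>lebesgue)"
      by (rule nn_integral_completion[symmetric])
    also have "\<dots> = (\<integral>\<^sup>+ s. ennreal (cmod (h s)) \<partial>lebesgue)"
      using h'(3) by (intro nn_integral_cong_AE) auto
    also have "\<dots> = ennreal (LINT s|lebesgue. cmod (h s))"
      using h by (intro nn_integral_eq_integral) auto
    finally show ?thesis .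
  qed
  have W: "(\<integral>\<^sup>+ s. ennreal ((cmod (w' s))\<^sup>2) \<partial>lborel) = ennreal (sq_norm w)"
    unfolding nn_integral_sq_norm[OF w, symmetric] nn_integral_completion using w'(3)
    by (intro nn_integral_cong_AE) auto
  have bound: "(\<integral>\<^sup>+ t. (?I t)\<^sup>2 \<partial>lborel) \<le> ennreal ((LINT s|lebesgue. cmod (h s))\<^sup>2 * sq_norm w)"
    using Young_nn_integral[OF h'(1) w'(1)] unfolding H W
    by (simp add: ennreal_power ennreal_mult sq_norm_nonneg)
  have "AE t in lborel. (?I t)\<^sup>2 \<noteq> \<infinity>"
    by (rule nn_integral_PInf_AE) (measurable, use bound in \<open>auto simp: top_unique\<close>)
  then have "AE t in lborel. integrable lebesgue (\<lambda>s. h s * w (t - s))"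
  proof eventually_elim
    case (elim t)
    then have "?I t < \<infinity>" by (auto simp: less_top power2_eq_square ennreal_mult_eq_top_iff)
    then show ?case unfolding cv(2) by (simp add: integrable_iff_bounded)
  qed
  then show "AE t in lebesgue. integrable lebesgue (\<lambda>s. h s * w (t - s))" by (rule AE_completion)
  have c: "convolve h w = (\<lambda>t. LINT s|lborel. h' s * w' (t - s))" by (rule ext) (rule cv(1))
  have "convolve h w \<in> borel_measurable lborel" unfolding c by measurable
  then have m: "convolve h w \<in> borel_measurable lebesgue" by (rule measurable_completion)
  have "(\<integral>\<^sup>+ t. ennreal ((cmod (convolve h w t))\<^sup>2) \<partial>lebesgue) \<le> (\<integral>\<^sup>+ t. (?I t)\<^sup>2 \<partial>lborel)"
    unfolding nn_integral_completion
  proof (rule nn_integral_mono)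
    fix t
    have "(ennreal (cmod (convolve h w t)))\<^sup>2 \<le> (?I t)\<^sup>2"
      unfolding c by (intro power_mono norm_integral_le_nn_integral) simp
    then show "ennreal ((cmod (convolve h w t))\<^sup>2) \<le> (?I t)\<^sup>2" by (simp add: ennreal_power)
  qed
  from order_trans[OF this bound]
  have le: "(\<integral>\<^sup>+ t. ennreal ((cmod (convolve h w t))\<^sup>2) \<partial>lebesgue) \<le> ennreal ((LINT s|lebesgue. cmod (h s))\<^sup>2 * sq_norm w)" .
  then show L: "convolve h w \<in> L2" unfolding L2_iff using m by (auto intro: le_less_trans)
  show "sq_norm (convolve h w) \<le> (LINT s|lebesgue. cmod (h s))\<^sup>2 * sq_norm w"
    by (rule sq_norm_le_nn[OF L le]) (simp add: sq_norm_nonneg)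
qed

theorem fourier_L1_convolve:
  fixes h w :: "'a::euclidean_space \<Rightarrow> complex"
  assumes h: "integrable lebesgue h" and w: "integrable lebesgue w"
  shows "integrable lebesgue (convolve h w)" "fourier_L1 (convolve h w) \<xi> = fourier_L1 h \<xi> * fourier_L1 w \<xi>"
proof -
  have hm: "h \<in> borel_measurable lebesgue" "w \<in> borel_measurable lebesgue" using h w by auto
  obtain h' where h': "h' \<in> borel_measurable borel" "integrable lborel h'" "AE s in lebesgue. h s = h' s" "fourier_L1 h = fourier_L1 h'"
    using borel_representative_integral[OF h] by blast
  obtain w' where w': "w' \<in> borel_measurable borel" "integrable lborel w'" "AE s in lebesgue. w s = w' s" "fourier_L1 w = fourier_L1 w'"
    using borel_representative_integral[OF w] by blast
  note [measurable] = h'(1) w'(1)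
  have c: "convolve h w = (\<lambda>t. LINT s|lborel. h' s * w' (t - s))"
    by (rule ext) (rule convolve_lebesgue_to_lborel(1)[OF hm(1) h'(1,3) hm(2) w'(1,3)])
  have cm: "convolve h w \<in> borel_measurable borel"
    unfolding c using lborel.borel_measurable_lebesgue_integral[of "\<lambda>t s. h' s * w' (t - s)" borel] by simp
  have shift: "(\<integral>\<^sup>+ t. ennreal (cmod (w' (t - s))) \<partial>lborel) = (\<integral>\<^sup>+ t. ennreal (cmod (w' t)) \<partial>lborel)" for s
    using lborel_nn_integral_shift[of "\<lambda>t. ennreal (cmod (w' t))" "- s"] by simp
  have "(\<integral>\<^sup>+ s. \<integral>\<^sup>+ t. ennreal (cmod (h' s * w' (t - s))) \<partial>lborel \<partial>lborel) =
      (\<integral>\<^sup>+ s. ennreal (cmod (h' s)) * (\<integral>\<^sup>+ t. ennreal (cmod (w' t)) \<partial>lborel) \<partial>lborel)"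
    by (simp add: norm_mult ennreal_mult nn_integral_cmult shift)
  also have "\<dots> < \<infinity>"
    using h'(2) w'(2) by (simp add: nn_integral_multc integrable_iff_bounded ennreal_mult_less_top)
  finally have fin: "(\<integral>\<^sup>+ s. \<integral>\<^sup>+ t. ennreal (cmod (h' s * w' (t - s))) \<partial>lborel \<partial>lborel) < \<infinity>" .
  have "integrable lborel (convolve h w)"
    unfolding c by (rule integrable_iterated_lborel[OF convolution_kernel_measurable[OF h'(1) w'(1)] fin])
  then show "integrable lebesgue (convolve h w)"
    using cm by (simp add: integrable_completion)
  let ?e = "\<lambda>t. cis (- 2 * pi * (t \<bullet> \<xi>))"
  have m: "(\<lambda>(s, t). h' s * w' (t - s) * ?e t) \<in> borel_measurable borel"
  proof -
    have "(\<lambda>(s, t). h' s * w' (t - s) * ?e t) \<in> borel_measurable (borel \<Otimes>\<^sub>M borel)" by measurable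
    then show ?thesis by (simp add: borel_prod)
  qed
  have fin': "(\<integral>\<^sup>+ s. \<integral>\<^sup>+ t. ennreal (cmod (h' s * w' (t - s) * ?e t)) \<partial>lborel \<partial>lborel) < \<infinity>"
    using fin by (simp add: norm_mult)
  have "fourier_L1 (convolve h w) \<xi> = (LINT t|lborel. LINT s|lborel. h' s * w' (t - s) * ?e t)"
    unfolding fourier_L1_lborel[OF cm] by (simp add: c)
  also have "\<dots> = (LINT s|lborel. LINT t|lborel. h' s * w' (t - s) * ?e t)"
    by (rule Fubini_lborel[OF m fin', symmetric])
  also have "\<dots> = (LINT s|lborel. h' s * ?e s * fourier_L1 w' \<xi>)"
  proof (intro Bochner_Integration.integral_cong refl)
    fix s
    have ce: "?e (s + t) = ?e s * ?e t" for t
      by (simp add: cis_mult inner_add_left algebra_simps)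
    have "(LINT t|lborel. h' s * w' (t - s) * ?e t) = (LINT t|lborel. h' s * w' (s + 1 *\<^sub>R t - s) * ?e (s + 1 *\<^sub>R t))"
      by (subst lborel_integral_affine[where c=1 and t=s]) auto
    also have "\<dots> = (LINT t|lborel. h' s * ?e s * (w' t * ?e t))"
      by (intro Bochner_Integration.integral_cong refl) (simp only: scaleR_one add_diff_cancel_left' ce, simp only: mult_ac)
    finally show "(LINT t|lborel. h' s * w' (t - s) * ?e t) = h' s * ?e s * fourier_L1 w' \<xi>"
      by (simp add: fourier_L1_lborel[OF w'(1)])
  qed
  also have "\<dots> = fourier_L1 h \<xi> * fourier_L1 w \<xi>"
    by (simp add: h'(4) w'(4) fourier_L1_lborel[OF h'(1)])
  finally show "fourier_L1 (convolve h w) \<xi> = fourier_L1 h \<xi> * fourier_L1 w \<xi>" .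
qed

text \<open>
  Formally the transform of \<open>convolve h w\<close> is the product of the transforms. For truncations of \<open>w\<close> this
  holds by Fubini's theorem, and Plancherel's theorem shows that their convolutions with \<open>h\<close> have norm
  tending to 0; by Young's inequality they also tend to \<open>convolve h w\<close>.
\<close>

lemma convolve_eq_0:
  fixes h w :: "'a::euclidean_space \<Rightarrow> complex"
  assumes h: "integrable lebesgue h" and w: "w \<in> L2"
    and zero: "AE \<xi> in lebesgue. fourier_L1 h \<xi> * fourier_L2 w \<xi> = 0"
  shows "AE t in lebesgue. convolve h w t = 0"
proof -
  define H where "H = (LINT s|lebesgue. cmod (h s))"
  have H: "0 \<le> H" by (simp add: H_def)
  let ?w = "\<lambda>n. trunc n w" and ?k = "\<lambda>n. convolve h (trunc n w)"
  note tr = trunc_L2[OF w]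
  have C: "convolve h w \<in> L2" and k: "?k n \<in> L2" for n
    using Young_convolve_L1_L2(2)[OF h] w tr(1) by blast+
  have ki: "integrable lebesgue (?k n)" for n by (rule fourier_L1_convolve(1)[OF h tr(2)])
  have D: "(\<lambda>s. ?w n s - w s) \<in> L2" for n by (rule L2_diff[OF tr(1) w])
  have small: "sq_norm (?k n) \<le> H\<^sup>2 * sq_norm (\<lambda>\<xi>. fourier_L1 (?w n) \<xi> - fourier_L2 w \<xi>)" for n
  proof -
    have "sq_norm (?k n) = sq_norm (fourier_L1 (?k n))" by (rule Plancherel_L1_L2[OF k ki, symmetric])
    also have "\<dots> \<le> H\<^sup>2 * sq_norm (\<lambda>\<xi>. fourier_L1 (?w n) \<xi> - fourier_L2 w \<xi>)"
    proof (rule L2_bound(2)[OF _ _ _ H])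
      show "(\<lambda>\<xi>. fourier_L1 (?w n) \<xi> - fourier_L2 w \<xi>) \<in> L2"
        by (intro L2_diff tr fourier_L2_in_L2 w)
      show "fourier_L1 (?k n) \<in> borel_measurable lebesgue"
        by (rule L2_measurable[OF fourier_L1_contraction(1)[OF k ki]])
      show "AE \<xi> in lebesgue. cmod (fourier_L1 (?k n) \<xi>) \<le> H * cmod (fourier_L1 (?w n) \<xi> - fourier_L2 w \<xi>)"
        using zero
      proof eventually_elim
        case (elim \<xi>)
        then have "fourier_L1 (?k n) \<xi> = fourier_L1 h \<xi> * (fourier_L1 (?w n) \<xi> - fourier_L2 w \<xi>)"
          unfolding fourier_L1_convolve(2)[OF h tr(2)] by (simp add: right_diff_distrib)
        then show ?case
          unfolding H_def by (simp add: norm_mult mult_right_mono fourier_L1_bound[OF h])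
      qed
    qed
    finally show ?thesis .
  qed
  have near: "sq_norm (\<lambda>t. convolve h w t - ?k n t) \<le> H\<^sup>2 * sq_norm (\<lambda>s. ?w n s - w s)" for n
  proof -
    have "AE t in lebesgue. convolve h w t - ?k n t = - convolve h (\<lambda>s. ?w n s - w s) t"
      using Young_convolve_L1_L2(1)[OF h w] Young_convolve_L1_L2(1)[OF h tr(1)[of n]]
      by eventually_elim (simp add: convolve_def right_diff_distrib)
    moreover have CD: "convolve h (\<lambda>s. ?w n s - w s) \<in> L2" by (rule Young_convolve_L1_L2(2)[OF h D])
    ultimately have "sq_norm (\<lambda>t. convolve h w t - ?k n t) = sq_norm (\<lambda>t. - convolve h (\<lambda>s. ?w n s - w s) t)"
      by (intro sq_norm_AE_cong borel_measurable_uminus L2_measurable[OF CD] L2_measurable[OF L2_diff[OF C k]])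
    also have "\<dots> = sq_norm (convolve h (\<lambda>s. ?w n s - w s))" by (simp add: sq_norm_def)
    also have "\<dots> \<le> H\<^sup>2 * sq_norm (\<lambda>s. ?w n s - w s)"
      unfolding H_def by (rule Young_convolve_L1_L2(3)[OF h D])
    finally show ?thesis .
  qed
  have lw: "(\<lambda>n. sq_norm (\<lambda>s. ?w n s - w s)) \<longlonglongrightarrow> 0"
    using L2_tendsto_iff[of ?w w, OF tr(1) w] L2_tendsto_trunc[OF w] by blast
  have lF: "(\<lambda>n. sq_norm (\<lambda>\<xi>. fourier_L1 (?w n) \<xi> - fourier_L2 w \<xi>)) \<longlonglongrightarrow> 0"
    using L2_tendsto_iff[of "\<lambda>n. fourier_L1 (?w n)" "fourier_L2 w", OF tr(3) fourier_L2_in_L2[OF w]]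
      fourier_L2_trunc[OF w w] by blast
  have le: "sq_norm (convolve h w) \<le> 2 * (H\<^sup>2 * sq_norm (\<lambda>s. ?w n s - w s)) +
      2 * (H\<^sup>2 * sq_norm (\<lambda>\<xi>. fourier_L1 (?w n) \<xi> - fourier_L2 w \<xi>))" for n
  proof -
    have "sq_norm (convolve h w) \<le> 2 * sq_norm (\<lambda>t. convolve h w t - ?k n t) + 2 * sq_norm (?k n)"
      using L2_add(2)[OF L2_diff[OF C k[of n]] k[of n]] by simp
    with near[of n] small[of n] show ?thesis by linarith
  qed
  have lim: "(\<lambda>n. 2 * (H\<^sup>2 * sq_norm (\<lambda>s. ?w n s - w s)) +
      2 * (H\<^sup>2 * sq_norm (\<lambda>\<xi>. fourier_L1 (?w n) \<xi> - fourier_L2 w \<xi>))) \<longlonglongrightarrow> 0"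
    using tendsto_add[OF tendsto_mult_left[OF tendsto_mult_left[OF lw, of "H\<^sup>2"], of 2]
        tendsto_mult_left[OF tendsto_mult_left[OF lF, of "H\<^sup>2"], of 2]] by simp
  have "sq_norm (convolve h w) \<le> 0"
    by (rule LIMSEQ_le_const[OF lim]) (use le in blast)
  then have "sq_norm (convolve h w) = 0" using sq_norm_nonneg[of "convolve h w"] by linarith
  then show ?thesis using sq_norm_eq_0_iff[OF C] by simp
qed

section \<open>Gluing the solutions\<close>

lemma AE_ess_supp: "AE \<xi> in lebesgue. \<xi> \<notin> ess_supp g \<longrightarrow> g \<xi> = 0"
  using AE_vanishing_set[of g] by (simp add: ess_supp_def)

text \<open>
  In the integral of \<open>fourier_L1_product\<close> a frequency \<open>\<xi>\<close> is reached only through decompositions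
  \<open>\<xi> = \<eta> + (\<xi> - \<eta>)\<close>. If \<open>\<xi>\<close> avoids \<open>A + ess_supp (fourier_L2 v)\<close>, then every \<open>\<eta>\<close> in \<open>A\<close> leaves \<open>\<xi> - \<eta>\<close>
  outside the support of the transform of \<open>v\<close>, so that the values of \<open>fourier_L2 x\<close> on \<open>A\<close> do not count.
\<close>

lemma fourier_L1_product_eq:
  fixes x x' v :: "'a::euclidean_space \<Rightarrow> complex"
  assumes x: "x \<in> L2" and x': "x' \<in> L2" and v: "v \<in> L2"
    and agree: "AE \<eta> in lebesgue. \<eta> \<notin> A \<longrightarrow> fourier_L2 x \<eta> = fourier_L2 x' \<eta>"
    and \<xi>: "\<xi> \<notin> A + ess_supp (fourier_L2 v)"
  shows "fourier_L1 (\<lambda>s. x s * v s) \<xi> = fourier_L1 (\<lambda>s. x' s * v s) \<xi>"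
  unfolding fourier_L1_product[OF x v] fourier_L1_product[OF x' v]
proof (intro integral_cong_AE borel_measurable_times L2_measurable L2_reflect fourier_L2_in_L2 x x' v)
  show "AE \<eta> in lebesgue. fourier_L2 x \<eta> * fourier_L2 v (\<xi> - \<eta>) = fourier_L2 x' \<eta> * fourier_L2 v (\<xi> - \<eta>)"
    using agree AE_lebesgue_reflect[OF AE_ess_supp[of "fourier_L2 v"], of \<xi>]
  proof eventually_elim
    case (elim \<eta>)
    have "\<eta> \<in> A \<Longrightarrow> \<xi> - \<eta> \<notin> ess_supp (fourier_L2 v)"
      using \<xi> set_plus_intro[of \<eta> A "\<xi> - \<eta>" "ess_supp (fourier_L2 v)"] by auto
    with elim show ?case by (cases "\<eta> \<in> A") auto
  qed
qed

text \<open>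
  The data determined by \<open>x\<close> depend only on the transform of \<open>x\<close> outside \<open>A\<close>: modifying it on \<open>A\<close>
  changes the transform of \<open>x v\<close> only on a set where the transform of \<open>w\<close> is almost everywhere 0.
\<close>

theorem convolve_product_eq:
  fixes x x' v w :: "'a::euclidean_space \<Rightarrow> complex"
  assumes x: "x \<in> L2" and x': "x' \<in> L2" and v: "v \<in> L2" and w: "w \<in> L2"
    and agree: "AE \<eta> in lebesgue. \<eta> \<notin> A \<longrightarrow> fourier_L2 x \<eta> = fourier_L2 x' \<eta>"
    and null: "(A + ess_supp (fourier_L2 v)) \<inter> ess_supp (fourier_L2 w) \<in> null_sets lebesgue"
  shows "AE t in lebesgue. convolve (\<lambda>s. x s * v s) w t = convolve (\<lambda>s. x' s * v s) w t"
proof -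
  note i = L2_mult_integrable[OF x v] and i' = L2_mult_integrable[OF x' v]
  let ?h = "\<lambda>s. x s * v s - x' s * v s"
  have "AE \<xi> in lebesgue. fourier_L1 ?h \<xi> * fourier_L2 w \<xi> = 0"
    using AE_not_in[OF null] AE_ess_supp[of "fourier_L2 w"]
  proof eventually_elim
    case (elim \<xi>)
    then show ?case
      using fourier_L1_product_eq[OF x x' v agree, of \<xi>] by (auto simp: fourier_L1_diff[OF i i'])
  qed
  from convolve_eq_0[OF Bochner_Integration.integrable_diff[OF i i'] w this]
  show ?thesis
    using Young_convolve_L1_L2(1)[OF i w] Young_convolve_L1_L2(1)[OF i' w]
    by eventually_elim (simp add: convolve_def left_diff_distrib)
qed

lemma L2_sum:
  assumes "finite I" "\<And>i. i \<in> I \<Longrightarrow> f i \<in> L2"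
  shows "(\<lambda>s. \<Sum>i\<in>I. f i s) \<in> L2"
  using assms
proof (induction I)
  case empty
  show ?case by (simp add: L2_space_def)
next
  case (insert i I)
  then show ?case using L2_add(1)[of "f i" "\<lambda>s. \<Sum>i\<in>I. f i s"] by simp
qed

text \<open>
  The covering condition says that the complements of the sets \<open>A i\<close> are pairwise disjoint, so the
  restrictions of the \<open>f i\<close> to these complements can simply be added.
\<close>

lemma L2_glue:
  fixes f :: "'i \<Rightarrow> 'a::euclidean_space \<Rightarrow> complex"
  assumes I: "finite I" and f: "\<And>i. i \<in> I \<Longrightarrow> f i \<in> L2" and A: "\<And>i. i \<in> I \<Longrightarrow> A i \<in> sets lebesgue"
    and cover: "\<And>i j. i \<in> I \<Longrightarrow> j \<in> I \<Longrightarrow> i \<noteq> j \<Longrightarrow> A i \<union> A j = UNIV"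
  shows "\<exists>g\<in>L2. \<forall>i\<in>I. \<forall>s. s \<notin> A i \<longrightarrow> g s = f i s"
proof (intro bexI ballI allI impI)
  let ?g = "\<lambda>s. \<Sum>i\<in>I. if s \<in> A i then 0 else f i s"
  show "?g \<in> L2"
  proof (rule L2_sum[OF I])
    fix i assume i: "i \<in> I"
    have "(\<lambda>s. if s \<in> A i then 0 else f i s) \<in> borel_measurable lebesgue"
      using A[OF i] L2_measurable[OF f[OF i]] by measurable
    then show "(\<lambda>s. if s \<in> A i then 0 else f i s) \<in> L2"
      by (rule L2_bound(1)[OF f[OF i], where c=1]) auto
  qed
  fix i s assume i: "i \<in> I" and s: "s \<notin> A i"
  have "?g s = (\<Sum>j\<in>{i}. if s \<in> A j then 0 else f j s)"
    using I i cover[OF i] s by (intro sum.mono_neutral_right) auto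
  then show "?g s = f i s" using s by simp
qed

text \<open>
  With real \<open>v\<close> and \<open>w\<close> the data are real-linear in \<open>x\<close> and compatible with real parts.
\<close>

lemma convolve_product_Re:
  fixes x v w :: "'a::euclidean_space \<Rightarrow> complex"
  assumes "integrable lebesgue (\<lambda>s. x s * v s * w (t - s))" "range v \<subseteq> \<real>" "range w \<subseteq> \<real>"
  shows "convolve (\<lambda>s. complex_of_real (Re (x s)) * v s) w t = complex_of_real (Re (convolve (\<lambda>s. x s * v s) w t))"
proof -
  have eq: "complex_of_real (Re (x s)) * v s * w (t - s) = complex_of_real (Re (x s * v s * w (t - s)))" for s
  proof -
    obtain a b where "v s = complex_of_real a" "w (t - s) = complex_of_real b"
      using assms(2,3) by (metis Reals_cases range_subsetD)
    then show ?thesis by simp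
  qed
  show ?thesis
    unfolding convolve_def eq by (simp only: integral_complex_of_real integral_Re[OF assms(1)])
qed

theorem proposition4p4:
  fixes m :: nat
    and K :: "complex set"
    and v w y :: "nat \<Rightarrow> real ^ 'n \<Rightarrow> complex"
    and A :: "nat \<Rightarrow> (real ^ 'n) set"
  assumes "m \<ge> 1"
    and "K = \<real> \<or> K = UNIV"
    and "\<forall>i\<in>{1..m}. v i \<in> L2_space K \<and> w i \<in> L2_space K \<and> y i \<in> L2_space K"
    and "\<forall>i\<in>{1..m}. \<exists>x \<in> L2_space K.
           AE t in lebesgue. (LINT s|lebesgue. x s * v i s * w i (t - s)) = y i t"
    and "\<forall>i\<in>{1..m}. A i \<in> sets lebesgue"
    and "\<forall>i\<in>{1..m}.
           (A i + ess_supp (fourier_L2 (v i))) \<inter> ess_supp (fourier_L2 (w i)) \<in> null_sets lebesgue"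
    and "\<forall>i\<in>{1..m - 1}. A i \<union> (\<Inter>j\<in>{i + 1..m}. A j) = UNIV"
  shows "\<exists>x \<in> L2_space K. \<forall>i\<in>{1..m}.
           AE t in lebesgue. (LINT s|lebesgue. x s * v i s * w i (t - s)) = y i t"
proof -
  have vK: "v i \<in> L2_space K" and wK: "w i \<in> L2_space K" and yK: "y i \<in> L2_space K" if "i \<in> {1..m}" for i
    using assms(3) that by auto
  have v: "v i \<in> L2" and w: "w i \<in> L2" if "i \<in> {1..m}" for i
    using vK[OF that] wK[OF that] L2_space_subset_L2 by blast+
  obtain z where zK: "\<And>i. i \<in> {1..m} \<Longrightarrow> z i \<in> L2_space K"
    and zy: "\<And>i. i \<in> {1..m} \<Longrightarrow> AE t in lebesgue. convolve (\<lambda>s. z i s * v i s) (w i) t = y i t"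
    using bchoice[OF assms(4)[unfolded Bex_def]] unfolding convolve_def by blast
  have z: "z i \<in> L2" if "i \<in> {1..m}" for i by (rule L2_space_subset_L2[OF zK[OF that]])
  \<comment> \<open>The one-sided covering condition amounts to pairwise disjointness of the complements of the sets \<open>A i\<close>.\<close>
  have cover_less: "A i \<union> A j = UNIV" if "i \<in> {1..m}" "j \<in> {1..m}" "i < j" for i j
    using assms(7) that by fastforce
  have cover: "A i \<union> A j = UNIV" if "i \<in> {1..m}" "j \<in> {1..m}" "i \<noteq> j" for i j
    using cover_less[of i j] cover_less[of j i] that by (cases "i < j") auto
  have "\<exists>g\<in>L2. \<forall>i\<in>{1..m}. \<forall>s. s \<notin> A i \<longrightarrow> g s = fourier_L2 (z i) s"
    by (rule L2_glue) (use assms(5) cover in \<open>auto intro!: fourier_L2_in_L2 z\<close>)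
  then obtain g where g: "g \<in> L2" and gz: "\<And>i s. i \<in> {1..m} \<Longrightarrow> s \<notin> A i \<Longrightarrow> g s = fourier_L2 (z i) s"
    by blast
  define x where "x = inv_fourier_L2 g"
  have x: "x \<in> L2" unfolding x_def by (rule inv_fourier_L2_in_L2[OF g])
  have xy: "AE t in lebesgue. convolve (\<lambda>s. x s * v i s) (w i) t = y i t" if i: "i \<in> {1..m}" for i
  proof -
    have "AE \<eta> in lebesgue. \<eta> \<notin> A i \<longrightarrow> fourier_L2 x \<eta> = fourier_L2 (z i) \<eta>"
      using fourier_inv_fourier_L2[OF g] unfolding x_def by eventually_elim (simp add: gz[OF i])
    from convolve_product_eq[OF x z[OF i] v[OF i] w[OF i] this] assms(6) i
    have "AE t in lebesgue. convolve (\<lambda>s. x s * v i s) (w i) t = convolve (\<lambda>s. z i s * v i s) (w i) t"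
      by blast
    with zy[OF i] show ?thesis by eventually_elim simp
  qed
  from assms(2) show ?thesis
  proof
    assume K: "K = UNIV"
    show ?thesis unfolding K using xy unfolding convolve_def by (intro bexI[OF _ x] ballI)
  next
    assume K: "K = \<real>"
    \<comment> \<open>Gluing on asymmetric frequency sets can make \<open>x\<close> complex, but its real part solves the same equations.\<close>
    let ?r = "\<lambda>s. complex_of_real (Re (x s))"
    have "?r \<in> borel_measurable lebesgue" using L2_measurable[OF x] by measurable
    then have "?r \<in> L2"
      by (rule L2_bound(1)[OF x, where c=1]) (simp_all add: abs_Re_le_cmod)
    then have r: "?r \<in> L2_space K" unfolding K by (auto simp: L2_space_def)
    have "AE t in lebesgue. convolve (\<lambda>s. ?r s * v i s) (w i) t = y i t" if i: "i \<in> {1..m}" for i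
      using xy[OF i] Young_convolve_L1_L2(1)[OF L2_mult_integrable[OF x v[OF i]] w[OF i]]
    proof eventually_elim
      case (elim t)
      have "range (v i) \<subseteq> \<real>" "range (w i) \<subseteq> \<real>" "y i t \<in> \<real>"
        using vK[OF i] wK[OF i] yK[OF i] unfolding K by (auto simp: L2_space_def)
      with convolve_product_Re[OF elim(2)] elim(1) show ?case by simp
    qed
    then show ?thesis unfolding convolve_def by (intro bexI[OF _ r] ballI)
  qed
qed

end
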